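(* Let $x_f\in\mathbb R^d$ be a fixed future covariate value. Assume the following. (C1) For every $x$, the sequence (indexed by $n$) of conditional CDF estimators $\widehat F_{y|x}$ is consistent for a continuous CDF $F_{y|x}$ in sup norm: $\sup_u|\widehat F_{y|x}(u)-F_{y|x}(u)|\overset{P}{\to}0$. (C2) As $n\to\infty$: (C2.1) There exist $\sigma_\infty^2\in\mathbb R_+$ and $\tau_n\to\infty$ such that $$\tau_n(\widehat Y_f-\mathbb E\widehat Y_f)\overset{D}{\to}\mathcal N(0,\sigma_\infty^2),\qquad \tau_n(\widehat Y_f^*-\mathbb E^*\widehat Y_f^* )\overset{D^*}{\to}\mathcal N(0,\sigma_\infty^2)\ \text{ in probability},$$ where $\mathbb E\widehat Y_f=\mathcal J(F_{y|x_f})+o(1/\tau_n)$ and $\mathbb E^*\widehat Y_f^*=\mathcal J(\widehat F_{y|x_f})+o_p(1/\tau_n)$ for a functional $\mathcal J$ mapping CDFs to $\mathbb R$. (C2.2) $\mathcal J(\widehat F_{y|x_f})\overset{P}{\to}\mathcal J(F_{y|x_f})$. Then the predictive roots $R_f=Y_f-\widehat Y_f$ and $R_f^*=Y_f^*-\widehat Y_f^*$ of the Model-free bootstrap are asymptotically pertinent, i.e. all of the following hold: (1) $R_f=\epsilon_f+e_f$ and $R_f^*=\epsilon_f^*+e_f^*$. Here $\epsilon_f=Y_f-\mathcal J(F_{y|x_f})$ is a non-degenerate random variable concerning the distribution of the future response, $e_f$ is the model estimation error and converges to $0$ in probability, and $\epsilon_f^*=Y_f^*-\mathcal J(\widehat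 F_{y|x_f})$ and $e_f^*$ are their bootstrap analogues. (2) $\sup_x|\mathbb P^*(\epsilon_f^*\le x)-\mathbb P(\epsilon_f\le x)|\overset{P}{\to}0$ as $n\to\infty$. (3) There is a diverging sequence of positive numbers $a_n$ such that $a_ne_f$ and $a_ne_f^*$ converge to nondegenerate distributions, and $\sup_x|\mathbb P^*(a_ne_f^*\le x)-\mathbb P(a_ne_f\le x)|\overset{P}{\to}0$ as $n\to\infty$. (4) $\epsilon_f$ is independent of $e_f$ under the real-world probability $\mathbb P_1$, and $\epsilon_f^*$ is independent of $e_f^*$ in the bootstrap world (under the conditional probability $\mathbb P_3$, i.e. given the data).
   Context: **Data.** $(X_1,Y_1),\dots,(X_n,Y_n)$ are i.i.d. from a joint CDF $F$ on $\mathbb R^d\times\mathbb R$. The future pair $(X_f,Y_f)$ is independent of the data and has the same distribution, and we condition on $X_f=x_f$, so $Y_f\sim F_{y|x_f}$. $F_{y|x}$ is the conditional CDF of $Y$ given $X=x$. $\widehat F_{y|x}(u)=\widehat F(u|x)$ is an estimator of it computed from the data, itself a CDF in $u$, with quantile function $\widehat F^{-1}_{y|x}(p)=\inf\{y:\widehat F(y|x)\ge p\}$. Write $\mathbf X_n=(X_1,\dots,X_n)$, $\mathbf Y_n=(Y_1,\dots,Y_n)$. **Probability measures.** $\mathbb P_1(\cdot)=\mathbb P(\cdot\mid X_f=x_f)$ and $\mathbb P_3(\cdot)=\mathbb P(\cdot\mid X_f=x_f;(\mathbf X_n,\mathbf Y_n))$. The bootstrap-world probability is $\mathbb P^*(\cdot)=\mathbb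 P(\cdot\mid\mathbf X_n,\mathbf Y_n)$, with expectation $\mathbb E^*$ and convergence in distribution $D^*$. **Model-free bootstrap.** $\widehat Y_f=g(\{(X_i,Y_i)\}_{i=1}^n,x_f)$ is a chosen point predictor of $Y_f$. The estimated ranks are $\widehat U_i=\widehat F(Y_i|X_i)$. Conditionally on the data: $X_1^*,\dots,X_n^*$ are drawn at random with replacement from $\{X_1,\dots,X_n\}$ (random regressor scheme), or $X_i^*=X_i$ (fixed regressor scheme). $U_1^*,\dots,U_n^*$ are drawn at random with replacement from $\{\widehat U_1,\dots,\widehat U_n\}$. Set $Y_i^*=\widehat F^{-1}_{y|X_i^*}(U_i^* )$. $Y_f^*$ is an independent draw from $\widehat F_{y|x_f}$. Set $\widehat Y_f^*=g(\{(X_i^*,Y_i^* )\}_{i=1}^n,x_f)$. *)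

theory Defs
  imports "HOL-Probability.Probability"
begin

section \<open>Distribution functions\<close>

definition is_cdf :: "(real \<Rightarrow> real) \<Rightarrow> bool" where
  "is_cdf G \<longleftrightarrow> mono G \<and> (\<forall>a. continuous (at_right a) G) \<and>
     (G \<longlongrightarrow> 0) at_bot \<and> (G \<longlongrightarrow> 1) at_top"

text \<open>The law with distribution function \<open>G\<close> is \<^const>\<open>interval_measure\<close> applied to \<open>G\<close>.
  In \<open>quantile G p\<close> the infimum is the usual real one if \<open>0 < p < 1\<close>. If \<open>p \<le> G y\<close> holds for
  all or for no \<open>y\<close> (only possible for \<open>p \<le> 0\<close> and \<open>p \<ge> 1\<close>), the mathematical value is infinite and the library's arbitrary constants \<open>Inf UNIV\<close> and \<open>Inf {}\<close> are used instead.\<close>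

definition quantile :: "(real \<Rightarrow> real) \<Rightarrow> real \<Rightarrow> real" where
  "quantile G p = Inf {y. p \<le> G y}"

definition nondegenerate :: "real measure \<Rightarrow> bool" where
  "nondegenerate L \<longleftrightarrow> \<not> (\<exists>c. AE y in L. y = c)"


section \<open>Modes of convergence\<close>

definition tendsto_prob :: "'a measure \<Rightarrow> (nat \<Rightarrow> 'a \<Rightarrow> real) \<Rightarrow> real \<Rightarrow> bool" where
  "tendsto_prob M Z c \<longleftrightarrow> (\<forall>n. Z n \<in> borel_measurable M) \<and>
     (\<forall>\<delta>>0. (\<lambda>n. measure M {\<omega> \<in> space M. \<bar>Z n \<omega> - c\<bar> > \<delta>}) \<longlonglongrightarrow> 0)"

text \<open>Convergence in distribution, in probability, of random laws \<open>\<mu> n \<omega>\<close> to a fixed law: the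
  analogue of \<^const>\<open>weak_conv_m\<close>, i.e. distribution functions converge (now in probability) at
  every continuity point of the limit.\<close>

definition weak_conv_in_prob :: "'a measure \<Rightarrow> (nat \<Rightarrow> 'a \<Rightarrow> real measure) \<Rightarrow> real measure \<Rightarrow> bool" where
  "weak_conv_in_prob M \<mu> L \<longleftrightarrow>
     (\<forall>x. isCont (cdf L) x \<longrightarrow> tendsto_prob M (\<lambda>n \<omega>. cdf (\<mu> n \<omega>) x) (cdf L x))"


section \<open>The real world\<close>

type_synonym 'd obs = "(real ^ 'd) \<times> real"

type_synonym 'd sample = "nat \<Rightarrow> 'd obs"

text \<open>An outcome consists of the whole sequence of observations and of the future pair.\<close>

type_synonym 'd outcome = "'d sample \<times> 'd obs"

abbreviation X_fut :: "'d outcome \<Rightarrow> real ^ 'd" where "X_fut \<omega> \<equiv> fst (snd \<omega>)"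

abbreviation Y_fut :: "'d outcome \<Rightarrow> real" where "Y_fut \<omega> \<equiv> snd (snd \<omega>)"

text \<open>The first \<open>n\<close> observations, with 0-based indices.\<close>

definition data :: "nat \<Rightarrow> 'd outcome \<Rightarrow> 'd sample" where
  "data n \<omega> = restrict (fst \<omega>) {..<n}"

definition sample_space :: "nat \<Rightarrow> ('d::finite) sample measure" where
  "sample_space n = PiM {..<n} (\<lambda>_. borel)"

text \<open>\<open>F x u\<close> is a version of the conditional probability that \<open>Y \<le> u\<close> given \<open>X = x\<close>, where
  \<open>(X, Y)\<close> has law \<open>D\<close>.\<close>

definition cond_cdf :: "('d::finite) obs measure \<Rightarrow> (real ^ 'd \<Rightarrow> real \<Rightarrow> real) \<Rightarrow> bool" where
  "cond_cdf D F \<longleftrightarrow> (\<forall>x. is_cdf (F x)) \<and> (\<forall>u. (\<lambda>x. F x u) \<in> borel_measurable borel) \<and>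
     (\<forall>A \<in> sets borel. \<forall>u. measure D (A \<times> {..u}) = (\<integral>x. indicator A x * F x u \<partial>distr D borel fst))"

text \<open>The probability \<open>\<P>\<close>: the observations and the future pair are i.i.d. with law \<open>D\<close>.\<close>

definition real_world :: "('d::finite) obs measure \<Rightarrow> 'd outcome measure" where
  "real_world D = PiM UNIV (\<lambda>_. D) \<Otimes>\<^sub>M D"

text \<open>The probability \<open>\<P>\<^sub>1\<close>, i.e. \<open>\<P>\<close> conditional on \<open>X_fut = x\<close>. The lemmas at the end of this
  section show that it is a regular conditional probability of \<open>\<P>\<close> given \<open>X_fut\<close>.\<close>

definition cond_world ::
  "('d::finite) obs measure \<Rightarrow> (real ^ 'd \<Rightarrow> real \<Rightarrow> real) \<Rightarrow> real ^ 'd \<Rightarrow> 'd outcome measure" where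
  "cond_world D F x = PiM UNIV (\<lambda>_. D) \<Otimes>\<^sub>M (return borel x \<Otimes>\<^sub>M interval_measure (F x))"

lemma real_distribution_cdf:
  assumes "is_cdf G"
  shows "real_distribution (interval_measure G)" "cdf (interval_measure G) = G"
  using assms unfolding is_cdf_def mono_def
  by (auto intro!: real_distribution_interval_measure cdf_interval_measure)

lemma kernel_measurable:
  assumes "cond_cdf D F"
  shows "(\<lambda>x. interval_measure (F x)) \<in> borel \<rightarrow>\<^sub>M prob_algebra borel"
proof (rule measurable_prob_algebra_generated[where G="range (\<lambda>u::real. {..u})" and \<Omega>=UNIV])
  have rd: "real_distribution (interval_measure (F x))" and cF: "cdf (interval_measure (F x)) = F x" for x
    using assms real_distribution_cdf unfolding cond_cdf_def by auto
  show "sets borel = sigma_sets UNIV (range (\<lambda>u::real. {..u}))"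
    by (subst borel_eq_atMost) (auto simp: sets_measure_of)
  show "Int_stable (range (\<lambda>u::real. {..u}))"
    by (auto simp: Int_stable_def)
  show "prob_space (interval_measure (F x))" for x
    using rd real_distribution.axioms(1) by blast
  show "sets (interval_measure (F x)) = sets borel" for x
    by simp
  fix A assume "A \<in> range (\<lambda>u::real. {..u})"
  then obtain u where A: "A = {..u}" by auto
  have "emeasure (interval_measure (F x)) A = ennreal (F x u)" for x
  proof -
    interpret real_distribution "interval_measure (F x)" by (rule rd)
    show ?thesis
      using cF[of x] by (simp add: A emeasure_eq_measure cdf_def fun_eq_iff)
  qed
  moreover have "(\<lambda>x. F x u) \<in> borel_measurable borel"
    using assms by (auto simp: cond_cdf_def)
  ultimately show "(\<lambda>x. emeasure (interval_measure (F x)) A) \<in> borel_measurable borel"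
    by simp
qed auto

lemma joint_kernel_measurable:
  assumes "cond_cdf D F"
  shows "(\<lambda>x. return borel x \<Otimes>\<^sub>M interval_measure (F x)) \<in> borel \<rightarrow>\<^sub>M prob_algebra borel"
  using measurable_pair_prob[OF measurable_return_prob_space kernel_measurable[OF assms]]
  by (simp add: borel_prod)

lemma disintegration:
  fixes D :: "('d::finite) obs measure"
  assumes D: "prob_space D" "sets D = sets borel" and F: "cond_cdf D F"
  shows "D = distr D borel fst \<bind> (\<lambda>x. return borel x \<Otimes>\<^sub>M interval_measure (F x))"
    (is "D = ?\<mu> \<bind> ?K")
proof -
  interpret D: prob_space D by fact
  have fstD: "fst \<in> D \<rightarrow>\<^sub>M borel"
    using D(2) by (simp cong: measurable_cong_sets add: borel_prod[symmetric])
  interpret \<mu>: prob_space ?\<mu> by (rule D.prob_space_distr[OF fstD])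
  have K: "?K \<in> ?\<mu> \<rightarrow>\<^sub>M prob_algebra borel"
    using joint_kernel_measurable[OF F] by simp
  note K' = measurable_prob_algebraD[OF K]
  have sets_bind: "sets (?\<mu> \<bind> ?K) = sets borel"
    by (rule sets_bind'[OF _ K]) (simp add: space_prob_algebra \<mu>.prob_space_axioms)
  define E where "E = {A \<times> {..u::real} | A u. A \<in> sets (borel :: (real ^ 'd) measure)}"
  have gen: "sets (borel :: 'd obs measure) = sigma_sets UNIV E"
  proof -
    have "sets (borel \<Otimes>\<^sub>M borel) =
        sets (sigma (space (borel :: (real ^ 'd) measure) \<times> space (borel :: real measure))
          {a \<times> b | a b. a \<in> sets borel \<and> b \<in> range (\<lambda>u::real. {..u})})"
    proof (rule sets_pair_eq)
      show "sets (borel :: real measure) = sigma_sets (space borel) (range (\<lambda>u::real. {..u}))"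
        by (subst borel_eq_atMost) (auto simp: sets_measure_of)
      show "countable {UNIV :: (real ^ 'd) set}" "countable (range (\<lambda>i::nat. {..real i}))" by auto
      show "\<Union> (range (\<lambda>i::nat. {..real i})) = space borel" by (auto simp: real_arch_simple)
    qed (auto simp: sets.sigma_sets_eq[of "borel :: (real ^ 'd) measure", simplified])
    also have "{a \<times> b | a b. a \<in> sets (borel :: (real ^ 'd) measure) \<and> b \<in> range (\<lambda>u::real. {..u})} = E"
      by (auto simp: E_def)
    finally show ?thesis by (simp add: borel_prod[symmetric])
  qed
  show ?thesis
  proof (rule measure_eqI_generator_eq[where \<Omega>=UNIV and E=E and A="\<lambda>i. UNIV \<times> {..real i}"])
    have "(A \<times> {..u}) \<inter> (B \<times> {..v}) \<in> E"
      if "A \<in> sets borel" "B \<in> sets borel" for A B :: "(real ^ 'd) set" and u v :: real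
    proof -
      have "(A \<times> {..u}) \<inter> (B \<times> {..v}) = (A \<inter> B) \<times> {..min u v}" by auto
      then show ?thesis using that unfolding E_def by blast
    qed
    then show "Int_stable E"
      by (intro Int_stableI) (auto simp: E_def)
    fix S assume "S \<in> E"
    then obtain A u where S: "S = A \<times> {..u}" "A \<in> sets borel" by (auto simp: E_def)
    have *: "emeasure (?K x) S = ennreal (indicator A x * F x u)" for x
    proof -
      have rd: "real_distribution (interval_measure (F x))" "cdf (interval_measure (F x)) = F x"
        using F real_distribution_cdf unfolding cond_cdf_def by auto
      interpret K: real_distribution "interval_measure (F x)" by (rule rd)
      have "emeasure (?K x) S = emeasure (return borel x) A * emeasure (interval_measure (F x)) {..u}"
        unfolding S using S(2) by (subst K.emeasure_pair_measure_Times) auto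
      also have "\<dots> = ennreal (indicator A x * F x u)"
        using S(2) rd(2) by (auto simp: K.emeasure_eq_measure cdf_def fun_eq_iff split: split_indicator)
      finally show ?thesis .
    qed
    have F01: "0 \<le> F x u \<and> F x u \<le> 1" for x
    proof -
      have rd: "real_distribution (interval_measure (F x))" "cdf (interval_measure (F x)) = F x"
        using F real_distribution_cdf unfolding cond_cdf_def by auto
      interpret K: real_distribution "interval_measure (F x)" by (rule rd)
      show ?thesis using K.cdf_nonneg[of u] K.cdf_bounded_prob[of u] by (simp add: rd(2))
    qed
    have meas: "(\<lambda>x. F x u) \<in> borel_measurable borel"
      using F by (auto simp: cond_cdf_def)
    have "S \<in> sets borel"
      unfolding S borel_prod[symmetric] using S(2) by auto
    then have "emeasure (?\<mu> \<bind> ?K) S = (\<integral>\<^sup>+x. emeasure (?K x) S \<partial>?\<mu>)"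
      by (intro emeasure_bind[OF _ K']) auto
    also have "\<dots> = (\<integral>\<^sup>+x. ennreal (indicator A x * F x u) \<partial>?\<mu>)"
      by (simp only: *)
    also have "\<dots> = ennreal (\<integral>x. indicator A x * F x u \<partial>?\<mu>)"
    proof (rule nn_integral_eq_integral)
      show "integrable ?\<mu> (\<lambda>x. indicator A x * F x u)"
        using S(2) meas F01
        by (intro \<mu>.integrable_const_bound[where B=1] AE_I2) (auto split: split_indicator)
    qed (use F01 in \<open>auto split: split_indicator\<close>)
    also have "\<dots> = emeasure D S"
      using F S by (simp add: cond_cdf_def D.emeasure_eq_measure)
    finally show "emeasure D S = emeasure (?\<mu> \<bind> ?K) S" ..
  next
    show "range (\<lambda>i. UNIV \<times> {..real i}) \<subseteq> E" by (auto simp: E_def)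
    show "(\<Union>i. UNIV \<times> {..real i}) = (UNIV :: 'd obs set)"
      by (auto simp: real_arch_simple)
    show "emeasure D (UNIV \<times> {..real i}) \<noteq> \<infinity>" for i by simp
  qed (use gen sets_bind D(2) in auto)
qed

lemma cond_world_kernel:
  fixes D :: "('d::finite) obs measure"
  assumes D: "prob_space D" "sets D = sets borel" and F: "cond_cdf D F"
  shows "cond_world D F \<in> borel \<rightarrow>\<^sub>M prob_algebra (real_world D)"
    and "sets (cond_world D F x) = sets (real_world D)"
    and "AE \<omega> in cond_world D F x. X_fut \<omega> = x"
proof -
  interpret D: prob_space D by fact
  interpret N: product_prob_space "\<lambda>_. D" UNIV by standard
  have N: "PiM UNIV (\<lambda>_. D) \<in> space (prob_algebra (PiM UNIV (\<lambda>_::nat. D)))"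
    using D(1) by (auto simp: space_prob_algebra intro: prob_space_PiM)
  have "cond_world D F \<in> borel \<rightarrow>\<^sub>M prob_algebra (PiM UNIV (\<lambda>_. D) \<Otimes>\<^sub>M borel)"
    unfolding cond_world_def
    using measurable_pair_prob[OF measurable_const[OF N] joint_kernel_measurable[OF F]] .
  moreover have *: "sets (PiM UNIV (\<lambda>_::nat. D) \<Otimes>\<^sub>M borel) = sets (real_world D)"
    unfolding real_world_def by (intro sets_pair_measure_cong) (simp_all add: D)
  moreover have "prob_algebra (PiM UNIV (\<lambda>_::nat. D) \<Otimes>\<^sub>M borel) = prob_algebra (real_world D)"
    by (simp only: prob_algebra_def subprob_algebra_cong[OF *])
  ultimately show k: "cond_world D F \<in> borel \<rightarrow>\<^sub>M prob_algebra (real_world D)"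
    by simp
  show s: "sets (cond_world D F x) = sets (real_world D)"
    using measurable_space[OF k, of x] by (simp add: space_prob_algebra)
  interpret K: prob_space "interval_measure (F x)"
    using F real_distribution_cdf(1) real_distribution.axioms(1) unfolding cond_cdf_def by blast
  interpret R: prob_space "return borel x" by (rule prob_space_return) simp
  interpret RK: pair_prob_space "return borel x" "interval_measure (F x)" ..
  interpret W: pair_prob_space "PiM UNIV (\<lambda>_::nat. D)" "return borel x \<Otimes>\<^sub>M interval_measure (F x)" ..
  have "{p \<in> space (return borel x \<Otimes>\<^sub>M interval_measure (F x)). fst p = x} = {x} \<times> UNIV"
    by (auto simp: space_pair_measure)
  moreover have "{x} \<times> UNIV \<in> sets (return borel x \<Otimes>\<^sub>M interval_measure (F x))"
    by (rule pair_measureI) auto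
  ultimately have 1: "AE p in return borel x \<Otimes>\<^sub>M interval_measure (F x). fst p = x"
    by (intro RK.AE_pair_measure) (simp, simp add: AE_return)
  show "AE \<omega> in cond_world D F x. X_fut \<omega> = x"
    unfolding cond_world_def
  proof (rule W.AE_pair_measure)
    let ?W = "PiM UNIV (\<lambda>_::nat. D) \<Otimes>\<^sub>M (return borel x \<Otimes>\<^sub>M interval_measure (F x))"
    have "fst \<in> return borel x \<Otimes>\<^sub>M interval_measure (F x) \<rightarrow>\<^sub>M (borel :: (real ^ 'd) measure)"
      by (rule measurable_fst'') (simp add: measurable_ident_sets)
    then have "(\<lambda>\<omega>. X_fut \<omega>) \<in> ?W \<rightarrow>\<^sub>M borel"
      by (rule measurable_compose[OF measurable_snd])
    from measurable_sets[OF this, of "{x}"]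
    show "{\<omega> \<in> space ?W. X_fut \<omega> = x} \<in> sets ?W"
      by (simp add: vimage_def Int_def conj_commute)
  qed (use 1 in simp)
qed

lemma cond_world_disintegrates:
  fixes D :: "('d::finite) obs measure"
  assumes D: "prob_space D" "sets D = sets borel" and F: "cond_cdf D F"
    and E: "E \<in> sets (real_world D)" and A: "A \<in> sets borel"
  shows "emeasure (real_world D) (E \<inter> {\<omega>. X_fut \<omega> \<in> A}) =
    (\<integral>\<^sup>+x. indicator A x * emeasure (cond_world D F x) E \<partial>distr D borel fst)"
proof -
  interpret D: prob_space D by fact
  interpret N: prob_space "PiM UNIV (\<lambda>_::nat. D)" by (rule prob_space_PiM) (rule D)
  interpret P: pair_prob_space "PiM UNIV (\<lambda>_::nat. D)" D ..
  let ?N = "PiM UNIV (\<lambda>_::nat. D)"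
  let ?K = "\<lambda>x. return borel x \<Otimes>\<^sub>M interval_measure (F x)"
  let ?E = "E \<inter> {\<omega>. X_fut \<omega> \<in> A}"
  have fstD: "fst \<in> D \<rightarrow>\<^sub>M borel"
    using D(2) by (simp cong: measurable_cong_sets add: borel_prod[symmetric])
  have "(\<lambda>\<omega>. X_fut \<omega>) \<in> real_world D \<rightarrow>\<^sub>M borel"
    unfolding real_world_def by (rule measurable_compose[OF measurable_snd fstD])
  then have "{\<omega> \<in> space (real_world D). X_fut \<omega> \<in> A} \<in> sets (real_world D)"
    using A by (auto simp: pred_def intro: measurable_sets_Collect)
  moreover have "?E = E \<inter> {\<omega> \<in> space (real_world D). X_fut \<omega> \<in> A}"
    using sets.sets_into_space[OF E] by auto
  ultimately have E': "?E \<in> sets (?N \<Otimes>\<^sub>M D)"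
    using E by (simp add: real_world_def)
  have sets_ND: "sets (?N \<Otimes>\<^sub>M ?K x) = sets (?N \<Otimes>\<^sub>M D)" for x
    by (intro sets_pair_measure_cong) (simp_all add: D borel_prod[symmetric])
  have h: "(\<lambda>p. emeasure ?N ((\<lambda>z. (z, p)) -` ?E)) \<in> borel_measurable D"
    using P.measurable_emeasure_Pair2[OF E'] .
  have h': "(\<lambda>p. emeasure ?N ((\<lambda>z. (z, p)) -` ?E)) \<in> borel_measurable borel"
    using h D(2) by (simp cong: measurable_cong_sets)
  have K: "?K \<in> distr D borel fst \<rightarrow>\<^sub>M subprob_algebra borel"
    using measurable_prob_algebraD[OF joint_kernel_measurable[OF F]] by simp
  have "emeasure (real_world D) ?E = (\<integral>\<^sup>+p. emeasure ?N ((\<lambda>z. (z, p)) -` ?E) \<partial>D)"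
    unfolding real_world_def by (rule P.emeasure_pair_measure_alt2[OF E'])
  also have "\<dots> = (\<integral>\<^sup>+x. \<integral>\<^sup>+p. emeasure ?N ((\<lambda>z. (z, p)) -` ?E) \<partial>?K x \<partial>distr D borel fst)"
    by (subst disintegration[OF D F]) (rule nn_integral_bind[OF h' K])
  also have "\<dots> = (\<integral>\<^sup>+x. emeasure (cond_world D F x) ?E \<partial>distr D borel fst)"
  proof (rule nn_integral_cong)
    fix x
    interpret K: prob_space "interval_measure (F x)"
      using F real_distribution_cdf(1) real_distribution.axioms(1) unfolding cond_cdf_def by blast
    interpret R: prob_space "return borel x" by (rule prob_space_return) simp
    interpret RK: pair_prob_space "return borel x" "interval_measure (F x)" ..
    interpret W: pair_prob_space ?N "?K x" ..
    show "(\<integral>\<^sup>+p. emeasure ?N ((\<lambda>z. (z, p)) -` ?E) \<partial>?K x) = emeasure (cond_world D F x) ?E"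
      unfolding cond_world_def using W.emeasure_pair_measure_alt2 E' sets_ND by simp
  qed
  also have "\<dots> = (\<integral>\<^sup>+x. indicator A x * emeasure (cond_world D F x) E \<partial>distr D borel fst)"
  proof (rule nn_integral_cong)
    fix x
    have ae: "AE \<omega> in cond_world D F x. X_fut \<omega> = x" and s: "sets (cond_world D F x) = sets (real_world D)"
      using cond_world_kernel[OF D F] by auto
    have sE: "E \<in> sets (cond_world D F x)" "?E \<in> sets (cond_world D F x)"
      using E E' s by (simp_all add: real_world_def)
    show "emeasure (cond_world D F x) ?E = indicator A x * emeasure (cond_world D F x) E"
    proof (cases "x \<in> A")
      case True
      have "emeasure (cond_world D F x) ?E = emeasure (cond_world D F x) E"
        by (rule emeasure_eq_AE) (use ae True sE in auto)
      then show ?thesis using True by simp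
    next
      case False
      have "emeasure (cond_world D F x) ?E = emeasure (cond_world D F x) {}"
        by (rule emeasure_eq_AE) (use ae False sE in auto)
      then show ?thesis using False by simp
    qed
  qed
  finally show ?thesis .
qed


section \<open>The bootstrap world\<close>

datatype scheme = Random_Regressors | Fixed_Regressors

text \<open>An outcome \<open>((I, J), y)\<close> of the bootstrap experiment consists of the indices \<open>I i\<close> and
  \<open>J i\<close> of the regressor and of the estimated rank drawn at the \<open>i\<close>-th step, and of the future
  bootstrap response \<open>y\<close>. Drawing indices instead of values gives tied values their multiplicity.\<close>

type_synonym boot_outcome = "((nat \<Rightarrow> nat) \<times> (nat \<Rightarrow> nat)) \<times> real"

abbreviation Y_fut_boot :: "boot_outcome \<Rightarrow> real" where "Y_fut_boot w \<equiv> snd w"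

definition index_pmf :: "nat \<Rightarrow> (nat \<Rightarrow> nat) pmf" where
  "index_pmf n = Pi_pmf {..<n} 0 (\<lambda>_. pmf_of_set {..<n})"

text \<open>The probability \<open>\<P>\<^sup>*\<close> (equally \<open>\<P>\<^sub>3\<close>) if the estimator takes the value \<open>G\<close> on the data, so
  that \<open>G x\<close> is the estimated conditional distribution function at \<open>x\<close>.\<close>

definition boot_world :: "nat \<Rightarrow> (real ^ 'd \<Rightarrow> real \<Rightarrow> real) \<Rightarrow> real ^ 'd \<Rightarrow> boot_outcome measure" where
  "boot_world n G x\<^sub>f =
     measure_pmf (pair_pmf (index_pmf n) (index_pmf n)) \<Otimes>\<^sub>M interval_measure (G x\<^sub>f)"

text \<open>The bootstrap sample obtained from the sample \<open>z\<close>. The estimator value \<open>G\<close> is the one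
  computed from \<open>z\<close>, both in the ranks and in the quantiles.\<close>

definition boot_data ::
  "scheme \<Rightarrow> nat \<Rightarrow> (real ^ 'd \<Rightarrow> real \<Rightarrow> real) \<Rightarrow> 'd sample \<Rightarrow> boot_outcome \<Rightarrow> 'd sample" where
  "boot_data s n G z = (\<lambda>((I, J), _). \<lambda>i\<in>{..<n}.
     let x = fst (z (case s of Random_Regressors \<Rightarrow> I i | Fixed_Regressors \<Rightarrow> i));
         u = G (fst (z (J i))) (snd (z (J i)))
     in (x, quantile (G x) u))"

end

theory Submission
  imports Defs
begin

text \<open>The observations and the future pair are independent, so the real world (given \<open>X_fut\<close>) and
  the bootstrap world are both products of an experiment that yields the predictor and an experiment
  that yields the response. The errors \<open>e\<close>, \<open>e_boot\<close> are functions of the first factor and the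
  errors \<open>\<epsilon>\<close>, \<open>\<epsilon>_boot\<close> of the second, which gives the independence claims.

  The distribution function of \<open>\<epsilon>\<close> is \<open>F x\<^sub>f\<close> shifted by \<open>\<J> (F x\<^sub>f)\<close>, and that of \<open>\<epsilon>_boot\<close> is
  the estimate \<open>Fn x\<^sub>f\<close> shifted by \<open>\<J> (Fn x\<^sub>f)\<close>. Their sup distance is at most the sup distance of \<open>Fn x\<^sub>f\<close>
  and \<open>F x\<^sub>f\<close> plus the effect on \<open>F x\<^sub>f\<close> of moving the shift. Both are small with high
  probability, the second because a continuous distribution function is uniformly continuous
  (\<open>cdf_uniformly_continuous\<close>).

  For the estimation errors take \<open>a = \<tau>\<close>. In either world the scaled error is \<open>- Z - c\<close>, where \<open>Z\<close> is the
  centred and scaled predictor and \<open>c\<close> is its scaled bias, which tends to \<open>0\<close>. The normal limit of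
  \<open>Z\<close> is symmetric and continuous, so neither the reflection nor the vanishing shift changes the
  limit law, and convergence is uniform in the argument (\<open>reflected_slutsky_in_prob\<close>). Hence both
  distribution functions are uniformly close to the same normal one, and so to each other. The
  unscaled errors vanish because \<open>a\<close> diverges.

  Convergence at each point in probability does not provide one outcome at which it holds at
  all points, so a pointwise application of Polya's theorem is not possible. Instead a finite
  grid that depends only on the limit law and the accuracy controls the whole distribution
  function (\<open>cdf_close_on_finite_set\<close>), and finitely many small probabilities add up to a small one
  (\<open>tendsto_prob_controlled\<close>). The real world is the case where all laws are constant in the outcome.

  Convergence in probability includes measurability in the data of bootstrap
  probabilities and of their suprema. The former are finite sums over the possible index draws,
  with quantiles characterised by inequalities on the distribution function; the latter reduce to countable
  suprema by right-continuity.\<close>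

section \<open>Continuous distribution functions\<close>

lemma cdf_tails:
  assumes "real_distribution L" and "\<eta> > 0"
  obtains A B where "\<And>x. x \<le> A \<Longrightarrow> cdf L x < \<eta>" "\<And>x. x \<ge> B \<Longrightarrow> cdf L x > 1 - \<eta>"
proof -
  interpret real_distribution L by fact
  have "\<forall>\<^sub>F x in at_bot. cdf L x < \<eta>" "\<forall>\<^sub>F x in at_top. cdf L x > 1 - \<eta>"
    using order_tendstoD(2)[OF cdf_lim_at_bot] order_tendstoD(1)[OF cdf_lim_at_top_prob] \<open>\<eta> > 0\<close>
    by auto
  then show ?thesis
    using that by (auto simp: eventually_at_bot_linorder eventually_at_top_linorder)
qed

text \<open>Compactness gives uniform continuity on a bounded interval, and beyond it the
  distribution function is within \<open>\<eta>\<close> of its limit. The interval overlaps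
  both tails by \<open>1\<close>, so that two points at distance at most \<open>1\<close> lie in the interval or in the same tail.\<close>

lemma cdf_uniformly_continuous:
  assumes L: "real_distribution L" and cont: "\<And>x. isCont (cdf L) x" and "\<eta> > 0"
  obtains \<delta> where "\<delta> > 0" "\<And>x y. \<bar>x - y\<bar> \<le> \<delta> \<Longrightarrow> \<bar>cdf L x - cdf L y\<bar> \<le> \<eta>"
proof -
  interpret real_distribution L by fact
  obtain A B where A: "\<And>x. x \<le> A \<Longrightarrow> cdf L x < \<eta>" and B: "\<And>x. x \<ge> B \<Longrightarrow> cdf L x > 1 - \<eta>"
    using cdf_tails[OF L \<open>\<eta> > 0\<close>] by blast
  have "uniformly_continuous_on {A - 1..B + 1} (cdf L)"
    by (intro compact_uniformly_continuous continuous_at_imp_continuous_on ballI cont) auto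
  then obtain d where d: "d > 0"
    "\<And>x y. x \<in> {A - 1..B + 1} \<Longrightarrow> y \<in> {A - 1..B + 1} \<Longrightarrow> dist y x < d \<Longrightarrow> dist (cdf L y) (cdf L x) < \<eta>"
    using \<open>\<eta> > 0\<close> unfolding uniformly_continuous_on_def by meson
  \<comment> \<open>Halving \<open>d\<close> turns the strict inequality of uniform continuity into a weak one.\<close>
  define \<delta> where "\<delta> = min 1 (d / 2)"
  \<comment> \<open>Either both points are in the same tail, or both are in the enlarged interval.\<close>
  have ordered: "\<bar>cdf L x - cdf L y\<bar> \<le> \<eta>" if "x \<le> y" "y - x \<le> \<delta>" for x y
  proof -
    consider "y \<le> A" | "x \<ge> B" | "y > A" "x < B" by linarith
    then show ?thesis
    proof cases
      case 1
      then show ?thesis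
        using A[of x] A[of y] cdf_nonneg[of x] cdf_nonneg[of y] that by linarith
    next
      case 2
      then show ?thesis
        using B[of x] B[of y] cdf_bounded_prob[of x] cdf_bounded_prob[of y] that by linarith
    next
      case 3
      then have "x \<in> {A - 1..B + 1}" "y \<in> {A - 1..B + 1}"
        using that by (auto simp: \<delta>_def)
      then have "dist (cdf L y) (cdf L x) < \<eta>"
        using d that by (auto simp: dist_real_def \<delta>_def)
      then show ?thesis by (simp add: dist_real_def abs_minus_commute)
    qed
  qed
  have "\<bar>cdf L x - cdf L y\<bar> \<le> \<eta>" if "\<bar>x - y\<bar> \<le> \<delta>" for x y
    using ordered[of x y] ordered[of y x] that by (cases "x \<le> y") (auto simp: abs_minus_commute)
  moreover have "\<delta> > 0"
    using \<open>d > 0\<close> by (simp add: \<delta>_def)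
  ultimately show ?thesis by (rule that[rotated])
qed

text \<open>The quantitative form of Polya's theorem. Between neighbouring grid points the limit varies by at
  most \<open>\<eta>\<close>, and monotonicity of the other distribution function interpolates. The grid does not depend on
  \<open>M\<close>, which makes the statement applicable to random laws.\<close>

lemma cdf_close_on_finite_set:
  assumes L: "real_distribution L" and cont: "\<And>x. isCont (cdf L) x" and "\<eta> > 0"
  obtains X :: "real set" where "finite X"
    "\<And>M x. real_distribution M \<Longrightarrow> (\<And>x. x \<in> X \<Longrightarrow> \<bar>cdf M x - cdf L x\<bar> \<le> \<eta>) \<Longrightarrow>
       \<bar>cdf M x - cdf L x\<bar> \<le> 2 * \<eta>"
proof -
  interpret L: real_distribution L by fact
  obtain A B where A: "\<And>x. x \<le> A \<Longrightarrow> cdf L x < \<eta>" and B: "\<And>x. x \<ge> B \<Longrightarrow> cdf L x > 1 - \<eta>"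
    using cdf_tails[OF L \<open>\<eta> > 0\<close>] by blast
  obtain \<delta> where \<delta>: "\<delta> > 0" "\<And>x y. \<bar>x - y\<bar> \<le> \<delta> \<Longrightarrow> \<bar>cdf L x - cdf L y\<bar> \<le> \<eta>"
    using cdf_uniformly_continuous[OF L cont \<open>\<eta> > 0\<close>] by blast
  obtain N :: nat where N: "B - A \<le> real N * \<delta>"
    using \<open>\<delta> > 0\<close> ex_less_of_nat_mult less_imp_le by metis
  define grid where "grid i = A + real i * \<delta>" for i
  have "\<bar>cdf M x - cdf L x\<bar> \<le> 2 * \<eta>"
    if M: "real_distribution M" and close: "\<And>x. x \<in> grid ` {..N} \<Longrightarrow> \<bar>cdf M x - cdf L x\<bar> \<le> \<eta>" for M x
  proof -
    interpret M: real_distribution M by fact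
    have close': "\<bar>cdf M (grid i) - cdf L (grid i)\<bar> \<le> \<eta>" if "i \<le> N" for i
      using close that by simp
    consider "x \<le> A" | "x \<ge> grid N" | "A < x" "x < grid N" by linarith
    then show ?thesis
    proof cases
      case 1
      then have "cdf M x \<le> cdf M (grid 0)"
        by (intro M.cdf_nondecreasing) (simp add: grid_def)
      moreover have "cdf L (grid 0) < \<eta>" "cdf L x < \<eta>" "grid 0 = A"
        using A 1 by (auto simp: grid_def)
      moreover have "cdf M (grid 0) \<le> cdf L (grid 0) + \<eta>"
        using close'[of 0] by linarith
      ultimately show ?thesis
        using M.cdf_nonneg[of x] L.cdf_nonneg[of x] by linarith
    next
      case 2
      then have "cdf M x \<ge> cdf M (grid N)" by (rule M.cdf_nondecreasing)
      moreover have "cdf L (grid N) > 1 - \<eta>" "cdf L x > 1 - \<eta>"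
        using B 2 N by (auto simp: grid_def)
      moreover have "cdf M (grid N) \<ge> cdf L (grid N) - \<eta>"
        using close'[of N] by linarith
      ultimately show ?thesis
        using M.cdf_bounded_prob[of x] L.cdf_bounded_prob[of x] by linarith
    next
      case 3
      \<comment> \<open>The grid cell that contains \<open>x\<close>.\<close>
      define i where "i = nat \<lfloor>(x - A) / \<delta>\<rfloor>"
      have i: "real i \<le> (x - A) / \<delta>" "(x - A) / \<delta> < real i + 1"
        using 3 \<open>\<delta> > 0\<close> by (auto simp: i_def of_nat_nat)
      then have x: "grid i \<le> x" "x \<le> grid (Suc i)" "grid (Suc i) = grid i + \<delta>"
        using \<open>\<delta> > 0\<close> by (auto simp: grid_def field_simps)
      have "real i < real N"
      proof -
        have "(x - A) / \<delta> < real N"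
          using 3 \<open>\<delta> > 0\<close> by (simp add: grid_def field_simps)
        then show ?thesis using i by linarith
      qed
      then have "i \<le> N" "Suc i \<le> N" by auto
      then have "\<bar>cdf M (grid i) - cdf L (grid i)\<bar> \<le> \<eta>" "\<bar>cdf M (grid (Suc i)) - cdf L (grid (Suc i))\<bar> \<le> \<eta>"
        using close' by auto
      moreover have "cdf M (grid i) \<le> cdf M x" "cdf M x \<le> cdf M (grid (Suc i))"
        using x by (auto intro: M.cdf_nondecreasing)
      moreover have "\<bar>cdf L (grid i) - cdf L x\<bar> \<le> \<eta>" "\<bar>cdf L (grid (Suc i)) - cdf L x\<bar> \<le> \<eta>"
        using x by (auto intro!: \<delta>(2))
      ultimately show ?thesis by linarith
    qed
  qed
  then show ?thesis by (intro that[of "grid ` {..N}"]) auto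
qed

text \<open>Reflection turns a distribution function into one minus a left limit. Passing to the left limit preserves
  the uniform bound, and symmetry and continuity of \<open>L\<close> turn the result back into its distribution function.\<close>

lemma reflected_shift_close:
  assumes L: "real_distribution L" and M: "real_distribution M"
    and cont: "\<And>x. isCont (cdf L) x" and sym: "\<And>x. cdf L (- x) = 1 - cdf L x"
    and close: "\<And>x. \<bar>cdf M x - cdf L x\<bar> \<le> \<eta>"
    and shift: "\<And>x. \<bar>cdf L (x + c) - cdf L x\<bar> \<le> \<eta>"
  shows "\<bar>measure M {y. - y - c \<le> x} - cdf L x\<bar> \<le> 2 * \<eta>"
proof -
  interpret L: real_distribution L by fact
  interpret M: real_distribution M by fact
  let ?a = "- x - c"
  have "((\<lambda>y. \<bar>cdf M y - cdf L y\<bar>) \<longlongrightarrow> \<bar>measure M {..<?a} - cdf L ?a\<bar>) (at_left ?a)"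
    using cont[of ?a]
    by (intro tendsto_intros M.cdf_at_left) (simp add: continuous_within filterlim_at_split isCont_def)
  then have "\<bar>measure M {..<?a} - cdf L ?a\<bar> \<le> \<eta>"
    by (rule tendsto_upperbound) (auto simp: close)
  moreover have "measure M {y. - y - c \<le> x} = 1 - measure M {..<?a}"
  proof -
    have "{y. - y - c \<le> x} = space M - {..<?a}" by auto
    then show ?thesis by (simp add: M.prob_compl del: M.space_eq_univ)
  qed
  moreover have "cdf L ?a = 1 - cdf L (x + c)"
    using sym[of "x + c"] by simp
  ultimately show ?thesis using shift[of x] by linarith
qed

text \<open>An almost surely constant value would be an atom, that is, a jump of the distribution function.\<close>

lemma nondegenerate_continuous_cdf:
  assumes "real_distribution L" and cont: "\<And>x. isCont (cdf L) x"
  shows "nondegenerate L"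
  unfolding nondegenerate_def
proof
  assume "\<exists>c. AE y in L. y = c"
  interpret real_distribution L by fact
  from \<open>\<exists>c. AE y in L. y = c\<close> obtain c where "AE y in L. y \<in> {c}" by auto
  then have "measure L {c} = 1" by (subst prob_eq_1) auto
  then show False using cont[of c] by (simp add: isCont_cdf)
qed

lemma normal_distribution:
  assumes "\<sigma> > 0"
  defines "L \<equiv> density lborel (normal_density 0 \<sigma>)"
  shows "real_distribution L" "\<And>x. isCont (cdf L) x" "\<And>x. cdf L (- x) = 1 - cdf L x"
proof -
  show L: "real_distribution L"
    unfolding L_def real_distribution_def real_distribution_axioms_def
    using prob_space_normal_density[OF \<open>\<sigma> > 0\<close>] by simp
  interpret real_distribution L by fact
  show cont: "isCont (cdf L) x" for x
  proof -
    have "AE y in lborel. y \<in> {x} \<longrightarrow> ennreal (normal_density 0 \<sigma> y) = 0"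
      using AE_lborel_singleton[of x] by eventually_elim simp
    then have "{x} \<in> null_sets L"
      unfolding L_def by (intro iffD2[OF null_sets_density_iff] conjI) auto
    then show ?thesis by (simp add: isCont_cdf measure_def null_setsD1)
  qed
  show "cdf L (- x) = 1 - cdf L x" for x
  proof -
    have "distributed L lborel (\<lambda>y. y) (normal_density 0 \<sigma>)"
      unfolding distributed_def L_def by (auto simp: distr_id2)
    \<comment> \<open>The law is invariant under \<open>y \<mapsto> - y\<close>, an affine map with slope \<open>- 1\<close>.\<close>
    from normal_density_affine[OF this \<open>\<sigma> > 0\<close>, of "-1" 0]
    have refl: "distr L lborel uminus = L"
      by (simp add: distributed_def L_def)
    have "cdf L (- x) = measure (distr L lborel uminus) {..- x}"
      by (simp add: refl cdf_def)
    also have "\<dots> = measure L {x..}"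
      by (subst measure_distr) (auto simp: vimage_def atLeast_def)
    also have "\<dots> = measure L (space L - {..<x})"
      by (rule arg_cong[where f="measure L"]) auto
    also have "\<dots> = 1 - measure L {..<x}"
      by (subst prob_compl) auto
    also have "measure L {..<x} = cdf L x"
    proof -
      have "{..x} = {..<x} \<union> {x}" by auto
      then have "cdf L x = measure L {..<x} + measure L {x}"
        unfolding cdf_def by (subst finite_measure_Union[symmetric]) auto
      then show ?thesis using cont[of x] by (simp add: isCont_cdf)
    qed
    finally show ?thesis .
  qed
qed

section \<open>Convergence in probability\<close>

lemma abs_le_SUP:
  fixes h :: "'a \<Rightarrow> real"
  assumes "\<And>x. \<bar>h x\<bar> \<le> B"
  shows "\<bar>h x\<bar> \<le> (SUP x. \<bar>h x\<bar>)"
  using assms by (intro cSUP_upper bdd_aboveI[of _ B]) auto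

lemma abs_SUP_abs_le:
  fixes h :: "'a \<Rightarrow> real"
  assumes "\<And>x. \<bar>h x\<bar> \<le> B"
  shows "\<bar>SUP x. \<bar>h x\<bar>\<bar> \<le> B"
proof -
  have "(SUP x. \<bar>h x\<bar>) \<le> B"
    by (rule cSUP_least) (use assms in auto)
  moreover have "\<bar>h undefined\<bar> \<le> (SUP x. \<bar>h x\<bar>)"
    by (rule abs_le_SUP) (rule assms)
  then have "0 \<le> (SUP x. \<bar>h x\<bar>)" by simp
  ultimately show ?thesis by simp
qed

lemma abs_diff_le_1:
  fixes p q :: real
  assumes "p \<in> {0..1}" "q \<in> {0..1}"
  shows "\<bar>p - q\<bar> \<le> 1"
  using assms by auto

text \<open>An epsilon-delta criterion: if a variable is close to its limit whenever finitely many variables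
  that converge in probability are close to theirs, then it converges in probability, by the union
  bound. The controlling set may depend on the accuracy, as the grid of
  \<open>cdf_close_on_finite_set\<close> does.\<close>

lemma tendsto_prob_controlled:
  assumes "prob_space M" and meas: "\<And>n. Z n \<in> borel_measurable M"
    and ctrl: "\<And>\<eta>. \<eta> > 0 \<Longrightarrow> \<exists>K \<delta>. finite K \<and> \<delta> > 0 \<and> (\<forall>(V, b)\<in>K. tendsto_prob M V b) \<and>
      (\<forall>\<^sub>F n in sequentially. \<forall>\<omega>\<in>space M. (\<forall>(V, b)\<in>K. \<bar>V n \<omega> - b\<bar> \<le> \<delta>) \<longrightarrow> \<bar>Z n \<omega> - c\<bar> \<le> \<eta>)"
  shows "tendsto_prob M Z c"
  unfolding tendsto_prob_def
proof (intro conjI allI impI meas)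
  interpret prob_space M by fact
  fix \<eta> :: real assume "\<eta> > 0"
  from ctrl[OF this] obtain K \<delta> where K: "finite K" "\<delta> > 0" "\<forall>(V, b)\<in>K. tendsto_prob M V b"
    and ev: "\<forall>\<^sub>F n in sequentially. \<forall>\<omega>\<in>space M. (\<forall>(V, b)\<in>K. \<bar>V n \<omega> - b\<bar> \<le> \<delta>) \<longrightarrow> \<bar>Z n \<omega> - c\<bar> \<le> \<eta>"
    by (elim exE conjE)
  define bad where "bad n k = {\<omega> \<in> space M. \<bar>fst k n \<omega> - snd k\<bar> > \<delta>}" for n and k :: "(nat \<Rightarrow> 'a \<Rightarrow> real) \<times> real"
  have bad_sets: "bad n k \<in> sets M" if "k \<in> K" for n k
  proof -
    obtain V b where k: "k = (V, b)" by (cases k)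
    then have [measurable]: "V n \<in> borel_measurable M"
      using K(3) that by (auto simp: tendsto_prob_def)
    show ?thesis unfolding bad_def k fst_conv snd_conv by measurable
  qed
  show "(\<lambda>n. measure M {\<omega> \<in> space M. \<bar>Z n \<omega> - c\<bar> > \<eta>}) \<longlonglongrightarrow> 0"
  proof (rule tendsto_sandwich[where f="\<lambda>_. 0" and h="\<lambda>n. \<Sum>k\<in>K. measure M (bad n k)"])
    show "\<forall>\<^sub>F n in sequentially. measure M {\<omega> \<in> space M. \<bar>Z n \<omega> - c\<bar> > \<eta>} \<le> (\<Sum>k\<in>K. measure M (bad n k))"
      using ev
    proof eventually_elim
      case (elim n)
      have "measure M {\<omega> \<in> space M. \<bar>Z n \<omega> - c\<bar> > \<eta>} \<le> measure M (\<Union>k\<in>K. bad n k)"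
      proof (rule finite_measure_mono)
        show "{\<omega> \<in> space M. \<bar>Z n \<omega> - c\<bar> > \<eta>} \<subseteq> (\<Union>k\<in>K. bad n k)"
        proof
          fix \<omega> assume "\<omega> \<in> {\<omega> \<in> space M. \<bar>Z n \<omega> - c\<bar> > \<eta>}"
          then have "\<omega> \<in> space M" and exceeds: "\<not> \<bar>Z n \<omega> - c\<bar> \<le> \<eta>" by auto
          then have "\<not> (\<forall>(V, b)\<in>K. \<bar>V n \<omega> - b\<bar> \<le> \<delta>)"
            using elim by blast
          with \<open>\<omega> \<in> space M\<close> show "\<omega> \<in> (\<Union>k\<in>K. bad n k)"
            by (auto simp: bad_def not_le intro!: bexI)
        qed
        show "(\<Union>k\<in>K. bad n k) \<in> sets M"
          using K(1) bad_sets by blast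
      qed
      also have "\<dots> \<le> (\<Sum>k\<in>K. measure M (bad n k))"
        using K(1) bad_sets by (intro finite_measure_subadditive_finite) auto
      finally show ?case .
    qed
    show "(\<lambda>n. \<Sum>k\<in>K. measure M (bad n k)) \<longlonglongrightarrow> 0"
    proof (rule tendsto_null_sum)
      fix k assume "k \<in> K"
      then have "tendsto_prob M (fst k) (snd k)" using K(3) by auto
      then show "(\<lambda>n. measure M (bad n k)) \<longlonglongrightarrow> 0"
        using K(2) unfolding tendsto_prob_def bad_def by blast
    qed
  qed auto
qed

lemma tendsto_prob_const_iff:
  assumes "prob_space M"
  shows "tendsto_prob M (\<lambda>n \<omega>. c n) b \<longleftrightarrow> c \<longlonglongrightarrow> b"
proof
  interpret prob_space M by fact
  assume *: "tendsto_prob M (\<lambda>n \<omega>. c n) b"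
  show "c \<longlonglongrightarrow> b"
  proof (rule LIMSEQ_I)
    fix r :: real assume "r > 0"
    then have "(\<lambda>n. measure M {\<omega> \<in> space M. \<bar>c n - b\<bar> > r / 2}) \<longlonglongrightarrow> 0"
      using * half_gt_zero unfolding tendsto_prob_def by blast
    \<comment> \<open>The event is deterministic, so its probability is \<open>0\<close> or \<open>1\<close>.\<close>
    then have "\<forall>\<^sub>F n in sequentially. measure M {\<omega> \<in> space M. \<bar>c n - b\<bar> > r / 2} < 1"
      by (rule order_tendstoD) simp
    then have "\<forall>\<^sub>F n in sequentially. norm (c n - b) < r"
    proof eventually_elim
      case (elim n)
      then have "\<not> \<bar>c n - b\<bar> > r / 2" by (auto simp: prob_space)
      then show ?case using \<open>r > 0\<close> by simp
    qed
    then show "\<exists>N. \<forall>n\<ge>N. norm (c n - b) < r" by (simp add: eventually_sequentially)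
  qed
next
  interpret prob_space M by fact
  assume "c \<longlonglongrightarrow> b"
  show "tendsto_prob M (\<lambda>n \<omega>. c n) b"
  proof (rule tendsto_prob_controlled[OF assms])
    fix \<eta> :: real assume "\<eta> > 0"
    with \<open>c \<longlonglongrightarrow> b\<close> have "\<forall>\<^sub>F n in sequentially. dist (c n) b < \<eta>" by (rule tendstoD)
    then have "\<forall>\<^sub>F n in sequentially. \<bar>c n - b\<bar> \<le> \<eta>"
      by eventually_elim (simp add: dist_real_def)
    then show "\<exists>K \<delta>. finite K \<and> \<delta> > 0 \<and> (\<forall>(V, b)\<in>K. tendsto_prob M V b) \<and>
      (\<forall>\<^sub>F n in sequentially. \<forall>\<omega>\<in>space M. (\<forall>(V, b)\<in>K. \<bar>V n \<omega> - b\<bar> \<le> \<delta>) \<longrightarrow> \<bar>c n - b\<bar> \<le> \<eta>)"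
      by (intro exI[of _ "{}"] exI[of _ 1]) (auto elim: eventually_mono)
  qed simp
qed

text \<open>Slutsky's lemma and Polya's theorem together, for random laws that converge in probability: the law of
  \<open>- Z - c\<close> with \<open>Z\<close> distributed as \<open>\<mu> n \<omega>\<close> is uniformly close to the symmetric limit \<open>L\<close>. The
  description of \<open>H\<close> is only asked for eventually, since a scaling sequence that diverges may
  have finitely many terms that are not positive.\<close>

lemma reflected_slutsky_in_prob:
  assumes P: "prob_space P" and L: "real_distribution L"
    and cont: "\<And>x. isCont (cdf L) x" and sym: "\<And>x. cdf L (- x) = 1 - cdf L x"
    and \<mu>: "\<And>n \<omega>. \<omega> \<in> space P \<Longrightarrow> real_distribution (\<mu> n \<omega>)" "weak_conv_in_prob P \<mu> L"
    and c: "tendsto_prob P c 0"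
    and H: "\<forall>\<^sub>F n in sequentially. \<forall>\<omega>\<in>space P. \<forall>x. H n \<omega> x = measure (\<mu> n \<omega>) {y. - y - c n \<omega> \<le> x}"
    and meas: "\<And>n. (\<lambda>\<omega>. SUP x. \<bar>H n \<omega> x - cdf L x\<bar>) \<in> borel_measurable P"
  shows "tendsto_prob P (\<lambda>n \<omega>. SUP x. \<bar>H n \<omega> x - cdf L x\<bar>) 0"
proof (rule tendsto_prob_controlled[OF P meas])
  fix \<eta> :: real assume "\<eta> > 0"
  then have "\<eta> / 4 > 0" by simp
  \<comment> \<open>One quarter: the grid doubles the error to \<open>\<eta> / 2\<close>, and the reflection doubles it again.\<close>
  obtain X where X: "finite X"
    "\<And>M x. real_distribution M \<Longrightarrow> (\<And>x. x \<in> X \<Longrightarrow> \<bar>cdf M x - cdf L x\<bar> \<le> \<eta> / 4) \<Longrightarrow>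
       \<bar>cdf M x - cdf L x\<bar> \<le> 2 * (\<eta> / 4)"
    using cdf_close_on_finite_set[OF L cont \<open>\<eta> / 4 > 0\<close>] by blast
  obtain d where d: "d > 0" "\<And>x y. \<bar>x - y\<bar> \<le> d \<Longrightarrow> \<bar>cdf L x - cdf L y\<bar> \<le> \<eta> / 4"
    using cdf_uniformly_continuous[OF L cont \<open>\<eta> / 4 > 0\<close>] by blast
  define \<delta> where "\<delta> = min d (\<eta> / 4)"
  define K where "K = insert (c, 0) ((\<lambda>x. ((\<lambda>n \<omega>. cdf (\<mu> n \<omega>) x), cdf L x)) ` X)"
  have "\<forall>\<^sub>F n in sequentially. \<forall>\<omega>\<in>space P. (\<forall>(V, b)\<in>K. \<bar>V n \<omega> - b\<bar> \<le> \<delta>) \<longrightarrow>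
      \<bar>(SUP x. \<bar>H n \<omega> x - cdf L x\<bar>) - 0\<bar> \<le> \<eta>"
    using H
  proof (eventually_elim, intro ballI impI)
    fix n \<omega> assume H': "\<forall>\<omega>\<in>space P. \<forall>x. H n \<omega> x = measure (\<mu> n \<omega>) {y. - y - c n \<omega> \<le> x}"
      and \<omega>: "\<omega> \<in> space P" and K': "\<forall>(V, b)\<in>K. \<bar>V n \<omega> - b\<bar> \<le> \<delta>"
    have close: "\<bar>cdf (\<mu> n \<omega>) x - cdf L x\<bar> \<le> \<eta> / 2" for x
      using X(2)[OF \<mu>(1)[OF \<omega>], of n x] K' by (fastforce simp: K_def \<delta>_def)
    have shift: "\<bar>cdf L (x + c n \<omega>) - cdf L x\<bar> \<le> \<eta> / 2" for x
      using d(2)[of "x + c n \<omega>" x] K' \<open>\<eta> > 0\<close> by (simp add: K_def \<delta>_def)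
    have *: "\<bar>H n \<omega> x - cdf L x\<bar> \<le> \<eta>" for x
      using reflected_shift_close[OF L \<mu>(1)[OF \<omega>] cont sym close shift] H' \<omega> by simp
    show "\<bar>(SUP x. \<bar>H n \<omega> x - cdf L x\<bar>) - 0\<bar> \<le> \<eta>"
      using abs_SUP_abs_le[of "\<lambda>x. H n \<omega> x - cdf L x", OF *] by simp
  qed
  moreover have "\<forall>(V, b)\<in>K. tendsto_prob P V b"
    using c \<mu>(2) cont by (auto simp: K_def weak_conv_in_prob_def)
  moreover have "finite K" "\<delta> > 0"
    using X(1) \<open>d > 0\<close> \<open>\<eta> > 0\<close> by (auto simp: K_def \<delta>_def)
  ultimately show "\<exists>K \<delta>. finite K \<and> \<delta> > 0 \<and> (\<forall>(V, b)\<in>K. tendsto_prob P V b) \<and>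
      (\<forall>\<^sub>F n in sequentially. \<forall>\<omega>\<in>space P. (\<forall>(V, b)\<in>K. \<bar>V n \<omega> - b\<bar> \<le> \<delta>) \<longrightarrow>
        \<bar>(SUP x. \<bar>H n \<omega> x - cdf L x\<bar>) - 0\<bar> \<le> \<eta>)"
    by blast
qed

text \<open>The right-hand side is small if \<open>a\<close> is large and \<open>G\<close> is a distribution function: a variable that
  needs a large factor to have a law near \<open>G\<close> is itself negligible.\<close>

lemma prob_exceeds_le:
  fixes f :: "'a \<Rightarrow> real"
  assumes M: "prob_space M" and f: "f \<in> borel_measurable M" and "a > 0"
    and close: "\<And>x. \<bar>measure M {w \<in> space M. a * f w \<le> x} - G x\<bar> \<le> \<eta>"
  shows "measure M {w \<in> space M. \<bar>f w\<bar> > \<delta>} \<le> 2 * \<eta> + G (- a * \<delta>) + (1 - G (a * \<delta>))"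
proof -
  interpret prob_space M by fact
  note [measurable] = f
  have "measure M {w \<in> space M. \<bar>f w\<bar> > \<delta>} \<le>
      measure M ({w \<in> space M. a * f w \<le> - a * \<delta>} \<union> {w \<in> space M. \<not> a * f w \<le> a * \<delta>})"
  proof (rule finite_measure_mono)
    show "{w \<in> space M. \<bar>f w\<bar> > \<delta>} \<subseteq>
        {w \<in> space M. a * f w \<le> - a * \<delta>} \<union> {w \<in> space M. \<not> a * f w \<le> a * \<delta>}"
    proof
      fix w assume w: "w \<in> {w \<in> space M. \<bar>f w\<bar> > \<delta>}"
      then consider "f w > \<delta>" | "f w \<le> - \<delta>" by fastforce
      then show "w \<in> {w \<in> space M. a * f w \<le> - a * \<delta>} \<union> {w \<in> space M. \<not> a * f w \<le> a * \<delta>}"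
        using w \<open>a > 0\<close> mult_left_mono[of "f w" "- \<delta>" a] by cases auto
    qed
  qed measurable
  also have "\<dots> \<le> measure M {w \<in> space M. a * f w \<le> - a * \<delta>} + measure M {w \<in> space M. \<not> a * f w \<le> a * \<delta>}"
    by (rule measure_Un_le) measurable
  also have "measure M {w \<in> space M. \<not> a * f w \<le> a * \<delta>} = 1 - measure M {w \<in> space M. a * f w \<le> a * \<delta>}"
    by (rule prob_neg) measurable
  finally show ?thesis
    using close[of "- a * \<delta>"] close[of "a * \<delta>"] by linarith
qed

section \<open>Measurability of suprema and quantiles\<close>

lemma right_continuous_prob_le:
  fixes f :: "'a \<Rightarrow> real"
  assumes "prob_space M" and [measurable]: "f \<in> borel_measurable M"
  shows "continuous (at_right a) (\<lambda>x. measure M {w \<in> space M. f w \<le> x})"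
proof -
  interpret prob_space M by fact
  interpret D: real_distribution "distr M borel f" by simp
  have "(\<lambda>x. measure M {w \<in> space M. f w \<le> x}) = cdf (distr M borel f)"
    by (auto simp: cdf_def measure_distr vimage_def Int_def conj_commute)
  then show ?thesis using D.cdf_is_right_cont by simp
qed

text \<open>A supremum of uncountably many measurable functions; by right-continuity the rational points suffice.\<close>

lemma borel_measurable_SUP_right_continuous:
  fixes H :: "'a \<Rightarrow> real \<Rightarrow> real"
  assumes meas: "\<And>x. (\<lambda>\<omega>. H \<omega> x) \<in> borel_measurable M"
    and rc: "\<And>\<omega> x. \<omega> \<in> space M \<Longrightarrow> continuous (at_right x) (H \<omega>)"
    and bdd: "\<And>\<omega> x. \<omega> \<in> space M \<Longrightarrow> H \<omega> x \<le> B"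
  shows "(\<lambda>\<omega>. SUP x. H \<omega> x) \<in> borel_measurable M"
proof -
  have "(SUP x. H \<omega> x) = (SUP x\<in>\<rat>. H \<omega> x)" if \<omega>: "\<omega> \<in> space M" for \<omega>
  proof (rule antisym)
    have bdd': "bdd_above (H \<omega> ` A)" for A
      using bdd[OF \<omega>] by (auto intro!: bdd_aboveI[of _ B])
    show "(SUP x\<in>\<rat>. H \<omega> x) \<le> (SUP x. H \<omega> x)"
      by (rule cSUP_subset_mono) (use bdd' Rats_0 in auto)
    show "(SUP x. H \<omega> x) \<le> (SUP x\<in>\<rat>. H \<omega> x)"
    proof (rule cSUP_least)
      fix x
      show "H \<omega> x \<le> (SUP x\<in>\<rat>. H \<omega> x)"
      proof (rule ccontr)
        assume "\<not> ?thesis"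
        moreover have "(H \<omega> \<longlongrightarrow> H \<omega> x) (at_right x)"
          using rc[OF \<omega>] by (simp add: continuous_within)
        ultimately have "\<forall>\<^sub>F y in at_right x. H \<omega> y > (SUP x\<in>\<rat>. H \<omega> x)"
          by (intro order_tendstoD) auto
        then obtain b where b: "b > x" "\<And>y. x < y \<Longrightarrow> y < b \<Longrightarrow> H \<omega> y > (SUP x\<in>\<rat>. H \<omega> x)"
          by (auto simp: eventually_at_right_field)
        obtain q where q: "q \<in> \<rat>" "x < q" "q < b"
          using Rats_dense_in_real[OF \<open>b > x\<close>] by blast
        have "H \<omega> q \<le> (SUP x\<in>\<rat>. H \<omega> x)"
          by (rule cSUP_upper[OF q(1) bdd'])
        then show False using b(2)[OF q(2,3)] by simp
      qed
    qed simp
  qed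
  moreover have "(\<lambda>\<omega>. SUP x\<in>\<rat>. H \<omega> x) \<in> borel_measurable M"
    using bdd by (intro borel_measurable_cSUP meas countable_rat bdd_aboveI[of _ B]) auto
  ultimately show ?thesis
    by (subst measurable_cong) auto
qed

lemma borel_measurable_cdf_distance:
  fixes H :: "'a \<Rightarrow> real \<Rightarrow> real"
  assumes meas: "\<And>x. (\<lambda>\<omega>. H \<omega> x) \<in> borel_measurable M"
    and H: "\<And>\<omega> x. \<omega> \<in> space M \<Longrightarrow> continuous (at_right x) (H \<omega>)"
      "\<And>\<omega> x. \<omega> \<in> space M \<Longrightarrow> H \<omega> x \<in> {0..1}"
    and G: "\<And>x. continuous (at_right x) G" "\<And>x. G x \<in> {0..1}"
  shows "(\<lambda>\<omega>. SUP x. \<bar>H \<omega> x - G x\<bar>) \<in> borel_measurable M"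
proof (rule borel_measurable_SUP_right_continuous)
  show "(\<lambda>\<omega>. \<bar>H \<omega> x - G x\<bar>) \<in> borel_measurable M" for x
    using meas by simp
  show "continuous (at_right x) (\<lambda>x. \<bar>H \<omega> x - G x\<bar>)" if "\<omega> \<in> space M" for \<omega> x
    by (intro continuous_rabs continuous_diff H(1)[OF that] G(1))
  show "\<bar>H \<omega> x - G x\<bar> \<le> 1" if "\<omega> \<in> space M" for \<omega> x
    by (rule abs_diff_le_1[OF H(2)[OF that] G(2)])
qed

text \<open>The infimum is attained by right-continuity. The assumptions on \<open>p\<close> make the set non-empty and
  bounded below, so that the infimum is the usual one.\<close>

lemma quantile_le_iff:
  assumes G: "is_cdf G" and "0 < p" "p \<le> G b"
  shows "quantile G p \<le> c \<longleftrightarrow> p \<le> G c"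
proof -
  let ?S = "{y. p \<le> G y}"
  have mono: "G x \<le> G y" if "x \<le> y" for x y
    using G that by (auto simp: is_cdf_def mono_def)
  have "\<forall>\<^sub>F y in at_bot. G y < p"
    using G \<open>0 < p\<close> by (intro order_tendstoD) (auto simp: is_cdf_def)
  then obtain A where A: "G A < p"
    by (auto simp: eventually_at_bot_linorder)
  have bdd: "bdd_below ?S"
  proof (rule bdd_belowI)
    fix y assume "y \<in> ?S"
    then show "A \<le> y" using A mono[of y A] by (cases "y \<le> A") auto
  qed
  have attained: "p \<le> G (Inf ?S)"
  proof (rule tendsto_lowerbound)
    show "(G \<longlongrightarrow> G (Inf ?S)) (at_right (Inf ?S))"
      using G by (auto simp: is_cdf_def continuous_within)
    have "p \<le> G y" if "y > Inf ?S" for y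
    proof -
      have "?S \<noteq> {}" using \<open>p \<le> G b\<close> by auto
      from cInf_lessD[OF this that] obtain z where "z \<in> ?S" "z < y" by blast
      then show ?thesis using mono[of z y] by auto
    qed
    then show "\<forall>\<^sub>F y in at_right (Inf ?S). p \<le> G y"
      by (auto simp: eventually_at_right_field intro: exI[of _ "Inf ?S + 1"])
  qed simp
  show ?thesis
  proof
    assume "quantile G p \<le> c"
    then show "p \<le> G c" using attained mono[of "Inf ?S" c] by (simp add: quantile_def)
  next
    assume "p \<le> G c"
    then show "quantile G p \<le> c" unfolding quantile_def by (intro cInf_lower bdd) auto
  qed
qed

text \<open>Ranks \<open>0\<close> and \<open>1\<close> can occur, and there \<^const>\<open>quantile\<close> may be one of the constants \<open>Inf UNIV\<close> and
  \<open>Inf {}\<close>. Which case applies is decided by the sign of the rank and by countably many comparisons.\<close>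

lemma borel_measurable_quantile:
  assumes G: "\<And>\<omega>. \<omega> \<in> space M \<Longrightarrow> is_cdf (G \<omega>)"
    and [measurable]: "\<And>y. (\<lambda>\<omega>. G \<omega> y) \<in> borel_measurable M" "U \<in> borel_measurable M"
  shows "(\<lambda>\<omega>. quantile (G \<omega>) (U \<omega>)) \<in> borel_measurable M"
proof (rule iffD2[OF borel_measurable_iff_le], rule allI)
  fix c :: real
  have "quantile (G \<omega>) (U \<omega>) \<le> c \<longleftrightarrow>
      (if U \<omega> \<le> 0 then Inf UNIV \<le> c
       else if \<exists>k::nat. U \<omega> \<le> G \<omega> (real k) then U \<omega> \<le> G \<omega> c else Inf {} \<le> c)"
    if \<omega>: "\<omega> \<in> space M" for \<omega>
  proof -
    have mono: "G \<omega> x \<le> G \<omega> y" if "x \<le> y" for x y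
      using G[OF \<omega>] that by (auto simp: is_cdf_def mono_def)
    consider "U \<omega> \<le> 0" | k :: nat where "0 < U \<omega>" "U \<omega> \<le> G \<omega> (real k)"
      | "0 < U \<omega>" "\<nexists>k::nat. U \<omega> \<le> G \<omega> (real k)"
      by (meson not_le)
    then show ?thesis
    proof cases
      case 1
      have "0 \<le> G \<omega> y" for y
        using real_distribution_cdf[OF G[OF \<omega>]] finite_borel_measure.cdf_nonneg
          real_distribution.finite_borel_measure_M by metis
      then have "U \<omega> \<le> G \<omega> y" for y
        using 1 order_trans by blast
      then show ?thesis using 1 by (simp add: quantile_def)
    next
      case 2
      then show ?thesis using quantile_le_iff[OF G[OF \<omega>]] by auto
    next
      case 3
      have "\<not> U \<omega> \<le> G \<omega> y" for y
      proof -
        obtain k :: nat where "y \<le> real k" using real_arch_simple by blast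
        then have "G \<omega> y \<le> G \<omega> (real k)" by (rule mono)
        then show ?thesis using 3 order_trans by blast
      qed
      then have "{y. U \<omega> \<le> G \<omega> y} = {}" by blast
      then show ?thesis using 3 by (simp add: quantile_def)
    qed
  qed
  then have "{\<omega> \<in> space M. quantile (G \<omega>) (U \<omega>) \<le> c} = {\<omega> \<in> space M.
      (if U \<omega> \<le> 0 then Inf UNIV \<le> c
       else if \<exists>k::nat. U \<omega> \<le> G \<omega> (real k) then U \<omega> \<le> G \<omega> c else Inf {} \<le> c)}"
    by (intro Collect_cong conj_cong refl)
  also have "\<dots> \<in> sets M" by measurable
  finally show "{\<omega> \<in> space M. quantile (G \<omega>) (U \<omega>) \<le> c} \<in> sets M" .
qed

section \<open>Product experiments\<close>

lemma measure_pair_fst: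
  assumes "prob_space M2" "A \<in> sets M1"
  shows "measure (M1 \<Otimes>\<^sub>M M2) (A \<times> space M2) = measure M1 A"
proof -
  interpret M2: prob_space M2 by fact
  show ?thesis
    using assms(2) by (simp add: measure_def M2.emeasure_pair_measure_Times M2.emeasure_space_1)
qed

lemma measure_pair_snd:
  assumes "prob_space M1" "prob_space M2" "A \<in> sets M2"
  shows "measure (M1 \<Otimes>\<^sub>M M2) (space M1 \<times> A) = measure M2 A"
proof -
  interpret M1: prob_space M1 by fact
  interpret M2: prob_space M2 by fact
  show ?thesis
    using assms(3) by (simp add: measure_def M2.emeasure_pair_measure_Times M1.emeasure_space_1)
qed

text \<open>The joint law of the two coordinates is the product of the marginal laws by construction of the product
  measure.\<close>

lemma indep_var_snd_fst:
  assumes "prob_space M1" "prob_space M2"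
    and f: "f \<in> M1 \<rightarrow>\<^sub>M (N1 :: 'c measure)" and g: "g \<in> M2 \<rightarrow>\<^sub>M (N2 :: 'c measure)"
  shows "prob_space.indep_var (M1 \<Otimes>\<^sub>M M2) N2 (\<lambda>w. g (snd w)) N1 (\<lambda>w. f (fst w))"
proof -
  interpret M1: prob_space M1 by fact
  interpret M2: prob_space M2 by fact
  interpret W: pair_prob_space M1 M2 ..
  interpret W': pair_prob_space M2 M1 ..
  note [measurable] = f g
  have "distr (M1 \<Otimes>\<^sub>M M2) N1 (\<lambda>w. f (fst w)) = distr M1 N1 f"
    using distr_distr[OF f measurable_fst, of M2] by (simp add: M2.distr_pair_fst comp_def)
  moreover have "distr (M1 \<Otimes>\<^sub>M M2) M2 snd = M2"
  proof (rule measure_eqI)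
    fix A assume "A \<in> sets (distr (M1 \<Otimes>\<^sub>M M2) M2 snd)"
    moreover from this have "snd -` A \<inter> space (M1 \<Otimes>\<^sub>M M2) = space M1 \<times> A"
      using sets.sets_into_space by (auto simp: space_pair_measure)
    ultimately show "emeasure (distr (M1 \<Otimes>\<^sub>M M2) M2 snd) A = emeasure M2 A"
      by (simp add: emeasure_distr M2.emeasure_pair_measure_Times M1.emeasure_space_1)
  qed simp
  then have "distr (M1 \<Otimes>\<^sub>M M2) N2 (\<lambda>w. g (snd w)) = distr M2 N2 g"
    using distr_distr[OF g measurable_snd, of M1] by (simp add: comp_def)
  moreover have "distr M2 N2 g \<Otimes>\<^sub>M distr M1 N1 f =
      distr (distr (M1 \<Otimes>\<^sub>M M2) (M2 \<Otimes>\<^sub>M M1) (\<lambda>(x, y). (y, x))) (N2 \<Otimes>\<^sub>M N1) (\<lambda>(x, y). (g x, f y))"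
    unfolding W'.distr_pair_swap[symmetric]
    by (rule pair_measure_distr[OF g f])
      (simp add: prob_space_imp_sigma_finite M1.prob_space_distr)
  moreover have "\<dots> = distr (M1 \<Otimes>\<^sub>M M2) (N2 \<Otimes>\<^sub>M N1) (\<lambda>w. (g (snd w), f (fst w)))"
    by (subst distr_distr) (auto simp: comp_def split_beta')
  ultimately show ?thesis
    unfolding W.indep_var_distribution_eq by simp
qed

section \<open>The bootstrap experiment as a function of the data\<close>

lemma finite_set_index_pmf: "finite (set_pmf (index_pmf n))"
proof -
  have "finite (set_pmf (pmf_of_set {..<n}))" if "i < n" for i
    using that by (subst set_pmf_of_set) auto
  then have "finite (PiE_dflt {..<n} 0 (set_pmf \<circ> (\<lambda>_. pmf_of_set {..<n})))"
    by (intro finite_PiE_dflt) auto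
  then show ?thesis
    unfolding index_pmf_def by (rule finite_subset[OF set_Pi_pmf_subset', rotated]) simp
qed

lemma prob_space_boot_world:
  assumes "is_cdf (G x)"
  shows "prob_space (boot_world n G x)"
proof -
  interpret real_distribution "interval_measure (G x)"
    using real_distribution_cdf[OF assms] by simp
  interpret pair_prob_space "measure_pmf (pair_pmf (index_pmf n) (index_pmf n))" "interval_measure (G x)" ..
  show ?thesis unfolding boot_world_def by (rule prob_space_axioms)
qed

text \<open>Only finitely many index draws have positive probability, so the probability of
  an event that concerns the draws only is a finite sum of indicators, with weights independent of the
  data. This is what makes it a measurable function of the data.\<close>

lemma measure_boot_world_indices:
  assumes "is_cdf (G x)"
  shows "measure (boot_world n G x) {w \<in> space (boot_world n G x). Q (fst w)} =
    (\<Sum>v\<in>set_pmf (pair_pmf (index_pmf n) (index_pmf n)).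
       pmf (pair_pmf (index_pmf n) (index_pmf n)) v * of_bool (Q v))"
proof -
  interpret real_distribution "interval_measure (G x)"
    using real_distribution_cdf[OF assms] by simp
  let ?p = "pair_pmf (index_pmf n) (index_pmf n)"
  have fin: "finite (set_pmf ?p)" by (simp add: finite_set_index_pmf)
  have "{w \<in> space (boot_world n G x). Q (fst w)} = {v. Q v} \<times> space (interval_measure (G x))"
    by (auto simp: boot_world_def space_pair_measure)
  then have "measure (boot_world n G x) {w \<in> space (boot_world n G x). Q (fst w)} = measure ?p {v. Q v}"
    using measure_pair_fst[OF prob_space_axioms, of "{v. Q v}" "measure_pmf ?p"]
    by (simp add: boot_world_def)
  also have "\<dots> = (\<Sum>v\<in>{v. Q v} \<inter> set_pmf ?p. pmf ?p v)"
    using fin by (subst measure_Int_set_pmf[symmetric], subst measure_measure_pmf_finite) auto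
  also have "\<dots> = (\<Sum>v\<in>set_pmf ?p. pmf ?p v * of_bool (Q v))"
    using fin by (intro sum.mono_neutral_cong_left) auto
  finally show ?thesis .
qed

lemma borel_measurable_boot_probability:
  assumes cdf: "\<And>\<omega>. \<omega> \<in> space M \<Longrightarrow> is_cdf (G \<omega> x)"
    and Q: "\<And>v. Measurable.pred M (\<lambda>\<omega>. Q \<omega> v)"
  shows "(\<lambda>\<omega>. measure (boot_world n (G \<omega>) x) {w \<in> space (boot_world n (G \<omega>) x). Q \<omega> (fst w)})
    \<in> borel_measurable M"
proof -
  note [measurable] = Q
  have "(\<lambda>\<omega>. \<Sum>v\<in>set_pmf (pair_pmf (index_pmf n) (index_pmf n)).
       pmf (pair_pmf (index_pmf n) (index_pmf n)) v * of_bool (Q \<omega> v)) \<in> borel_measurable M"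
    by measurable
  moreover have "measure (boot_world n (G \<omega>) x) {w \<in> space (boot_world n (G \<omega>) x). Q \<omega> (fst w)} =
      (\<Sum>v\<in>set_pmf (pair_pmf (index_pmf n) (index_pmf n)).
         pmf (pair_pmf (index_pmf n) (index_pmf n)) v * of_bool (Q \<omega> v))" if "\<omega> \<in> space M" for \<omega>
    by (rule measure_boot_world_indices[where G="G \<omega>" and x=x and Q="Q \<omega>", OF cdf[OF that]])
  ultimately show ?thesis
    by (subst measurable_cong) auto
qed

text \<open>Outside the index range a sample takes the constant value \<open>undefined\<close>, so the coordinate map is
  measurable at every index that the bootstrap draws may name.\<close>

lemma measurable_sample_component: "(\<lambda>z. z j) \<in> sample_space n \<rightarrow>\<^sub>M borel"
proof (cases "j < n")
  case True
  then show ?thesis unfolding sample_space_def by (intro measurable_component_singleton) simp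
next
  case False
  then have "z j = undefined" if "z \<in> space (sample_space n)" for z :: "nat \<Rightarrow> 'a obs"
    using that by (auto simp: sample_space_def space_PiM PiE_def extensional_def)
  then show ?thesis by (subst measurable_cong[where g="\<lambda>_. undefined"]) auto
qed

text \<open>Ranks and quantile functions are evaluated at arguments that depend on the data themselves, which
  is where joint measurability of the estimator enters.\<close>

lemma measurable_boot_data:
  fixes Fhat :: "('d::finite) sample \<Rightarrow> real ^ 'd \<Rightarrow> real \<Rightarrow> real"
  assumes cdf: "\<And>z x. z \<in> space (sample_space n) \<Longrightarrow> is_cdf (Fhat z x)"
    and meas: "(\<lambda>(z, x, u). Fhat z x u) \<in> borel_measurable (sample_space n \<Otimes>\<^sub>M borel \<Otimes>\<^sub>M borel)"
  shows "(\<lambda>z. boot_data s n (Fhat z) z w) \<in> sample_space n \<rightarrow>\<^sub>M sample_space n"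
proof -
  obtain I J y where w: "w = ((I, J), y)" by (metis surj_pair)
  have X: "(\<lambda>z. fst (z j)) \<in> sample_space n \<rightarrow>\<^sub>M (borel :: (real ^ 'd) measure)" for j
    by (rule measurable_compose[OF measurable_sample_component])
      (intro borel_measurable_continuous_onI continuous_intros)
  have Y: "(\<lambda>z :: 'd sample. snd (z j)) \<in> borel_measurable (sample_space n)" for j
    by (rule measurable_compose[OF measurable_sample_component])
      (intro borel_measurable_continuous_onI continuous_intros)
  have at_point: "(\<lambda>z. Fhat z (x z) (u z)) \<in> borel_measurable (sample_space n)"
    if "x \<in> sample_space n \<rightarrow>\<^sub>M borel" "u \<in> borel_measurable (sample_space n)" for x u
    using measurable_compose[OF measurable_Pair[OF measurable_ident measurable_Pair[OF that]] meas]
    by simp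
  have "(\<lambda>z. boot_data s n (Fhat z) z w) = (\<lambda>z. \<lambda>i\<in>{..<n}.
     (fst (z (case s of Random_Regressors \<Rightarrow> I i | Fixed_Regressors \<Rightarrow> i)),
      quantile (Fhat z (fst (z (case s of Random_Regressors \<Rightarrow> I i | Fixed_Regressors \<Rightarrow> i))))
        (Fhat z (fst (z (J i))) (snd (z (J i))))))"
    by (simp add: boot_data_def w Let_def)
  also have "\<dots> \<in> sample_space n \<rightarrow>\<^sub>M PiM {..<n} (\<lambda>_. borel \<Otimes>\<^sub>M borel)"
    by (intro measurable_restrict measurable_Pair borel_measurable_quantile at_point X Y cdf measurable_const) simp_all
  finally show ?thesis by (simp add: sample_space_def borel_prod)
qed

section \<open>Asymptotic pertinence of the predictive roots\<close>

theorem theorem5p3: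
  fixes D :: "('d::finite) obs measure"
    and F :: "real ^ 'd \<Rightarrow> real \<Rightarrow> real"
    and Fhat :: "nat \<Rightarrow> 'd sample \<Rightarrow> real ^ 'd \<Rightarrow> real \<Rightarrow> real"
    and g :: "nat \<Rightarrow> 'd sample \<Rightarrow> real ^ 'd \<Rightarrow> real"
    and s :: scheme
    and x\<^sub>f :: "real ^ 'd"
    and \<J> :: "(real \<Rightarrow> real) \<Rightarrow> real"
    and \<sigma>2 :: real
    and \<tau> :: "nat \<Rightarrow> real"
    and P P1 :: "'d outcome measure"
    and Pstar :: "nat \<Rightarrow> 'd outcome \<Rightarrow> boot_outcome measure"
    and Yhat :: "nat \<Rightarrow> 'd outcome \<Rightarrow> real"
    and Yhat_boot :: "nat \<Rightarrow> 'd outcome \<Rightarrow> boot_outcome \<Rightarrow> real"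
    and Fn :: "nat \<Rightarrow> 'd outcome \<Rightarrow> real ^ 'd \<Rightarrow> real \<Rightarrow> real"
    and R e :: "nat \<Rightarrow> 'd outcome \<Rightarrow> real"
    and \<epsilon> :: "'d outcome \<Rightarrow> real"
    and R_boot \<epsilon>_boot e_boot :: "nat \<Rightarrow> 'd outcome \<Rightarrow> boot_outcome \<Rightarrow> real"
  defines "P \<equiv> real_world D"
    and "P1 \<equiv> cond_world D F x\<^sub>f"
    and "Fn \<equiv> \<lambda>n \<omega>. Fhat n (data n \<omega>)"
    and "Pstar \<equiv> \<lambda>n \<omega>. boot_world n (Fn n \<omega>) x\<^sub>f"
    and "Yhat \<equiv> \<lambda>n \<omega>. g n (data n \<omega>) x\<^sub>f"
    and "Yhat_boot \<equiv> \<lambda>n \<omega> w. g n (boot_data s n (Fn n \<omega>) (data n \<omega>) w) x\<^sub>f"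
    and "R \<equiv> \<lambda>n \<omega>. Y_fut \<omega> - Yhat n \<omega>"
    and "\<epsilon> \<equiv> \<lambda>\<omega>. Y_fut \<omega> - \<J> (F x\<^sub>f)"
    and "e \<equiv> \<lambda>n \<omega>. \<J> (F x\<^sub>f) - Yhat n \<omega>"
    and "R_boot \<equiv> \<lambda>n \<omega> w. Y_fut_boot w - Yhat_boot n \<omega> w"
    and "\<epsilon>_boot \<equiv> \<lambda>n \<omega> w. Y_fut_boot w - \<J> (Fn n \<omega> x\<^sub>f)"
    and "e_boot \<equiv> \<lambda>n \<omega> w. \<J> (Fn n \<omega> x\<^sub>f) - Yhat_boot n \<omega> w"
  assumes D: "prob_space D" "sets D = sets borel"
    and F: "cond_cdf D F"
    and Fhat_cdf: "\<And>n z x. z \<in> space (sample_space n) \<Longrightarrow> is_cdf (Fhat n z x)"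
    and Fhat_measurable: "\<And>n. (\<lambda>(z, x, u). Fhat n z x u) \<in>
           borel_measurable (sample_space n \<Otimes>\<^sub>M borel \<Otimes>\<^sub>M borel)"
    and g_measurable: "\<And>n. (\<lambda>z. g n z x\<^sub>f) \<in> borel_measurable (sample_space n)"
    and C1: "\<And>x. continuous_on UNIV (F x)"
      "\<And>x. tendsto_prob P (\<lambda>n \<omega>. SUP u. \<bar>Fn n \<omega> x u - F x u\<bar>) 0"
    and C2_1: "\<sigma>2 > 0" "filterlim \<tau> at_top sequentially"
      "\<And>n. integrable P (Yhat n)"
      "weak_conv_m (\<lambda>n. distr P borel (\<lambda>\<omega>. \<tau> n * (Yhat n \<omega> - integral\<^sup>L P (Yhat n))))
         (density lborel (normal_density 0 (sqrt \<sigma>2)))"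
      "weak_conv_in_prob P
         (\<lambda>n \<omega>. distr (Pstar n \<omega>) borel
            (\<lambda>w. \<tau> n * (Yhat_boot n \<omega> w - integral\<^sup>L (Pstar n \<omega>) (Yhat_boot n \<omega>))))
         (density lborel (normal_density 0 (sqrt \<sigma>2)))"
      "(\<lambda>n. integral\<^sup>L P (Yhat n) - \<J> (F x\<^sub>f)) \<in> o(\<lambda>n. 1 / \<tau> n)"
      "tendsto_prob P
         (\<lambda>n \<omega>. \<tau> n * (integral\<^sup>L (Pstar n \<omega>) (Yhat_boot n \<omega>) - \<J> (Fn n \<omega> x\<^sub>f))) 0"
    and C2_2: "tendsto_prob P (\<lambda>n \<omega>. \<J> (Fn n \<omega> x\<^sub>f)) (\<J> (F x\<^sub>f))"
  shows
    "((\<forall>n \<omega>. R n \<omega> = \<epsilon> \<omega> + e n \<omega>) \<and>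
      (\<forall>n \<omega> w. R_boot n \<omega> w = \<epsilon>_boot n \<omega> w + e_boot n \<omega> w) \<and>
      nondegenerate (distr P1 borel \<epsilon>) \<and>
      tendsto_prob P1 e 0 \<and>
      (\<forall>\<delta>>0. tendsto_prob P
         (\<lambda>n \<omega>. measure (Pstar n \<omega>) {w \<in> space (Pstar n \<omega>). \<bar>e_boot n \<omega> w\<bar> > \<delta>}) 0)) \<and>
     tendsto_prob P (\<lambda>n \<omega>. SUP x.
        \<bar>measure (Pstar n \<omega>) {w \<in> space (Pstar n \<omega>). \<epsilon>_boot n \<omega> w \<le> x} -
         measure P1 {\<omega>' \<in> space P1. \<epsilon> \<omega>' \<le> x}\<bar>) 0 \<and>
     (\<exists>a :: nat \<Rightarrow> real. (\<forall>n. a n > 0) \<and> filterlim a at_top sequentially \<and>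
        (\<exists>L. real_distribution L \<and> nondegenerate L \<and>
           weak_conv_m (\<lambda>n. distr P1 borel (\<lambda>\<omega>. a n * e n \<omega>)) L) \<and>
        (\<exists>L. real_distribution L \<and> nondegenerate L \<and>
           weak_conv_in_prob P (\<lambda>n \<omega>. distr (Pstar n \<omega>) borel (\<lambda>w. a n * e_boot n \<omega> w)) L) \<and>
        tendsto_prob P (\<lambda>n \<omega>. SUP x.
          \<bar>measure (Pstar n \<omega>) {w \<in> space (Pstar n \<omega>). a n * e_boot n \<omega> w \<le> x} -
           measure P1 {\<omega>' \<in> space P1. a n * e n \<omega>' \<le> x}\<bar>) 0) \<and>
     ((\<forall>n. prob_space.indep_var P1 borel \<epsilon> borel (e n)) \<and>
      (\<forall>n. \<forall>\<omega> \<in> space P.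
         prob_space.indep_var (Pstar n \<omega>) borel (\<epsilon>_boot n \<omega>) borel (e_boot n \<omega>)))"
proof -
  interpret D: prob_space D by fact
  let ?N = "PiM UNIV (\<lambda>_::nat. D)"
  let ?B = "return borel x\<^sub>f \<Otimes>\<^sub>M interval_measure (F x\<^sub>f)"
  let ?\<I> = "\<lambda>n. measure_pmf (pair_pmf (index_pmf n) (index_pmf n))"
  interpret N: prob_space ?N by (rule prob_space_PiM) (rule D)
  have F_cdf: "is_cdf (F x\<^sub>f)"
    using F by (simp add: cond_cdf_def)
  interpret K: real_distribution "interval_measure (F x\<^sub>f)"
    by (rule real_distribution_cdf[OF F_cdf])
  note cdf_K = real_distribution_cdf(2)[OF F_cdf]
  interpret Rx: prob_space "return borel x\<^sub>f" by (rule prob_space_return) simp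
  interpret B: pair_prob_space "return borel x\<^sub>f" "interval_measure (F x\<^sub>f)" ..
  interpret P: pair_prob_space ?N D ..
  interpret P1: pair_prob_space ?N ?B ..
  have P: "prob_space P" unfolding P_def real_world_def by (rule P.prob_space_axioms)
  have P1: "prob_space P1" unfolding P1_def cond_world_def by (rule P1.prob_space_axioms)
  have sets_P1: "sets P1 = sets P"
    unfolding P_def P1_def by (rule cond_world_kernel[OF D F])

  define L where "L = density lborel (normal_density 0 (sqrt \<sigma>2))"
  have L: "real_distribution L" "\<And>x. isCont (cdf L) x" "\<And>x. cdf L (- x) = 1 - cdf L x"
    unfolding L_def using normal_distribution[of "sqrt \<sigma>2"] C2_1(1) by simp_all
  interpret L: real_distribution L by (rule L(1))
  have L_nondeg: "nondegenerate L" by (rule nondegenerate_continuous_cdf[OF L(1,2)])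

  have data_space: "data n \<omega> \<in> space (sample_space n)" for n \<omega>
    by (simp add: data_def sample_space_def space_PiM)
  have restrict_meas: "(\<lambda>z. restrict z {..<n}) \<in> ?N \<rightarrow>\<^sub>M sample_space n" for n
    unfolding sample_space_def
  proof (rule measurable_restrict)
    fix i assume "i \<in> {..<n}"
    have "(\<lambda>z. z i) \<in> ?N \<rightarrow>\<^sub>M D" by (rule measurable_component_singleton) simp
    then show "(\<lambda>z. z i) \<in> ?N \<rightarrow>\<^sub>M borel" using measurable_cong_sets[OF refl D(2)] by blast
  qed
  have data_meas: "data n \<in> P \<rightarrow>\<^sub>M sample_space n" for n
    unfolding data_def P_def real_world_def by (rule measurable_compose[OF measurable_fst restrict_meas])
  have Fn_cdf: "is_cdf (Fn n \<omega> x)" for n \<omega> x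
    unfolding Fn_def by (rule Fhat_cdf[OF data_space])
  note Fn_dist = real_distribution_cdf[OF Fn_cdf]
  have Pstar: "prob_space (Pstar n \<omega>)" for n \<omega>
    unfolding Pstar_def by (rule prob_space_boot_world[OF Fn_cdf])
  have J_meas: "(\<lambda>\<omega>. \<J> (Fn n \<omega> x\<^sub>f)) \<in> borel_measurable P" for n
    using C2_2 by (simp add: tendsto_prob_def)

  \<comment> \<open>The prediction error as a function of the sample alone, which is the first factor of the outcome.\<close>
  define h where "h n z = \<J> (F x\<^sub>f) - g n (restrict z {..<n}) x\<^sub>f" for n z
  have e_h: "e n \<omega> = h n (fst \<omega>)" for n \<omega>
    by (simp add: e_def h_def Yhat_def data_def)
  have h_meas: "h n \<in> borel_measurable ?N" for n
    unfolding h_def by (intro borel_measurable_diff borel_measurable_const measurable_compose[OF restrict_meas g_measurable])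
  have e_meas1: "e n \<in> borel_measurable P1" for n
    unfolding e_h[abs_def] P1_def cond_world_def by (rule measurable_compose[OF measurable_fst h_meas])

  \<comment> \<open>The bootstrap predictor as a function of the index draws \<open>v\<close>. The \<open>0\<close> stands in for the
    future response.\<close>
  define V where "V n \<omega> v = g n (boot_data s n (Fn n \<omega>) (data n \<omega>) (v, 0)) x\<^sub>f" for n \<omega> v
  have e_boot_V: "e_boot n \<omega> w = \<J> (Fn n \<omega> x\<^sub>f) - V n \<omega> (fst w)" for n \<omega> w
    by (simp add: e_boot_def Yhat_boot_def V_def boot_data_def split_beta)
  have V_meas: "(\<lambda>\<omega>. V n \<omega> v) \<in> borel_measurable P" for n v
    unfolding V_def Fn_def
    by (rule measurable_compose[OF data_meas measurable_compose[OF measurable_boot_data g_measurable]])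
      (use Fhat_cdf Fhat_measurable in auto)
  have e_boot_meas: "e_boot n \<omega> \<in> borel_measurable (Pstar n \<omega>)" for n \<omega>
    unfolding e_boot_V[abs_def] Pstar_def boot_world_def
    by (rule measurable_compose[OF measurable_fst]) simp
  have Y_boot_meas: "snd \<in> borel_measurable (Pstar n \<omega>)" for n \<omega>
    unfolding Pstar_def boot_world_def by (rule measurable_snd'') simp
  have boot_prob_meas: "(\<lambda>\<omega>. measure (Pstar n \<omega>) {w \<in> space (Pstar n \<omega>). Q (e_boot n \<omega> w)}) \<in> borel_measurable P"
    if Q: "Measurable.pred borel Q" for n Q
    unfolding Pstar_def e_boot_V
  proof (rule borel_measurable_boot_probability)
    show "is_cdf (Fn n \<omega> x\<^sub>f)" for \<omega> by (rule Fn_cdf)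
    show "Measurable.pred P (\<lambda>\<omega>. Q (\<J> (Fn n \<omega> x\<^sub>f) - V n \<omega> v))" for v
      by (rule measurable_compose[OF borel_measurable_diff[OF J_meas V_meas] Q])
  qed

  \<comment> \<open>The scaling has to be positive at every \<open>n\<close>, while \<open>\<tau>\<close> is only eventually positive.\<close>
  define a where "a n = (if \<tau> n > 0 then \<tau> n else 1)" for n
  have a_pos: "a n > 0" for n by (simp add: a_def)
  have a_\<tau>: "\<forall>\<^sub>F n in sequentially. a n = \<tau> n"
    using C2_1(2)[unfolded filterlim_at_top_dense, rule_format, of 0] by eventually_elim (simp add: a_def)
  have a_top: "filterlim a at_top sequentially"
    using C2_1(2) filterlim_cong[OF refl refl a_\<tau>] by simp

  define HR where "HR n x = measure P1 {\<omega>' \<in> space P1. a n * e n \<omega>' \<le> x}" for n x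
  define HB where "HB n \<omega> x = measure (Pstar n \<omega>) {w \<in> space (Pstar n \<omega>). a n * e_boot n \<omega> w \<le> x}" for n \<omega> x
  have HR_cdf: "HR n = cdf (distr P1 borel (\<lambda>\<omega>. a n * e n \<omega>))" for n
    using e_meas1 by (auto simp: HR_def cdf_def measure_distr vimage_def Int_def conj_commute)
  have HB_cdf: "HB n \<omega> = cdf (distr (Pstar n \<omega>) borel (\<lambda>w. a n * e_boot n \<omega> w))" for n \<omega>
    using e_boot_meas by (auto simp: HB_def cdf_def measure_distr vimage_def Int_def conj_commute)
  \<comment> \<open>Conditioning on the future regressor does not affect the law of the data, so the limit theorem
    under \<open>P\<close> applies under \<open>P1\<close>.\<close>
  have HR_P: "HR n x = measure P {\<omega> \<in> space P. a n * e n \<omega> \<le> x}" for n x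
  proof -
    let ?A = "{z \<in> space ?N. a n * h n z \<le> x}"
    have A: "?A \<in> sets ?N" using h_meas[of n] by measurable
    have "{\<omega> \<in> space P1. a n * e n \<omega> \<le> x} = ?A \<times> space ?B" "{\<omega> \<in> space P. a n * e n \<omega> \<le> x} = ?A \<times> space D"
      by (auto simp: P1_def P_def cond_world_def real_world_def space_pair_measure e_h)
    then show ?thesis
      using measure_pair_fst[OF B.prob_space_axioms A] measure_pair_fst[OF D(1) A]
      by (simp add: HR_def P1_def P_def cond_world_def real_world_def)
  qed
  have HR_rc: "continuous (at_right x) (HR n)" for x n
    unfolding HR_def using e_meas1 by (intro right_continuous_prob_le[OF P1]) simp
  have HB_rc: "continuous (at_right x) (HB n \<omega>)" for x n \<omega>
    unfolding HB_def using e_boot_meas by (intro right_continuous_prob_le[OF Pstar]) simp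
  have HR_01: "HR n x \<in> {0..1}" for n x
    using prob_space.prob_le_1[OF P1] by (simp add: HR_def)
  have HB_01: "HB n \<omega> x \<in> {0..1}" for n \<omega> x
    using prob_space.prob_le_1[OF Pstar] by (simp add: HB_def)
  have L_01: "cdf L x \<in> {0..1}" for x
    using L.cdf_nonneg L.cdf_bounded_prob by simp
  have HB_meas: "(\<lambda>\<omega>. HB n \<omega> x) \<in> borel_measurable P" for n x
    unfolding HB_def by (rule boot_prob_meas) simp

  \<comment> \<open>Distances to the common normal limit. All statements on \<open>e\<close> and \<open>e_boot\<close> follow from their
    convergence to \<open>0\<close>.\<close>
  define SR where "SR n = (SUP x. \<bar>HR n x - cdf L x\<bar>)" for n
  define SB where "SB n \<omega> = (SUP x. \<bar>HB n \<omega> x - cdf L x\<bar>)" for n \<omega>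
  have SR_ge: "\<bar>HR n x - cdf L x\<bar> \<le> SR n" for n x
    unfolding SR_def by (rule abs_le_SUP[OF abs_diff_le_1[OF HR_01 L_01]])
  have SB_ge: "\<bar>HB n \<omega> x - cdf L x\<bar> \<le> SB n \<omega>" for n \<omega> x
    unfolding SB_def by (rule abs_le_SUP[OF abs_diff_le_1[OF HB_01 L_01]])

  have SR: "SR \<longlonglongrightarrow> 0"
  proof -
    define Z where "Z n \<omega> = \<tau> n * (Yhat n \<omega> - integral\<^sup>L P (Yhat n))" for n \<omega>
    define c where "c n = \<tau> n * (integral\<^sup>L P (Yhat n) - \<J> (F x\<^sub>f))" for n
    have Z_meas: "Z n \<in> borel_measurable P" for n
      unfolding Z_def using C2_1(3) by simp
    have "tendsto_prob P (\<lambda>n \<omega>. SUP x. \<bar>HR n x - cdf L x\<bar>) 0"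
    proof (rule reflected_slutsky_in_prob[OF P L])
      show "real_distribution (distr P borel (Z n))" for n
        by (rule prob_space.real_distribution_distr[OF P Z_meas])
      show "weak_conv_in_prob P (\<lambda>n \<omega>. distr P borel (Z n)) L"
        using C2_1(4) unfolding weak_conv_in_prob_def tendsto_prob_const_iff[OF P]
        by (simp add: weak_conv_m_def weak_conv_def L_def Z_def[abs_def])
      show "tendsto_prob P (\<lambda>n \<omega>. c n) 0"
        using smalloD_tendsto[OF C2_1(6)] unfolding tendsto_prob_const_iff[OF P]
        by (simp add: c_def[abs_def] mult.commute)
      show "\<forall>\<^sub>F n in sequentially. \<forall>\<omega>\<in>space P. \<forall>x. HR n x = measure (distr P borel (Z n)) {y. - y - c n \<le> x}"
        using a_\<tau>
      proof eventually_elim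
        case (elim n)
        have "a n * e n \<omega> = - Z n \<omega> - c n" for \<omega>
          by (simp add: elim e_def Z_def c_def algebra_simps)
        then show ?case
          using Z_meas[of n] by (auto simp: HR_P measure_distr vimage_def Int_def conj_commute)
      qed
    qed simp
    then show ?thesis unfolding tendsto_prob_const_iff[OF P] SR_def[abs_def] .
  qed

  have SB: "tendsto_prob P SB 0"
  proof -
    define Z where "Z n \<omega> w = \<tau> n * (Yhat_boot n \<omega> w - integral\<^sup>L (Pstar n \<omega>) (Yhat_boot n \<omega>))" for n \<omega> w
    define c where "c n \<omega> = \<tau> n * (integral\<^sup>L (Pstar n \<omega>) (Yhat_boot n \<omega>) - \<J> (Fn n \<omega> x\<^sub>f))" for n \<omega>
    have Yhat_boot_e: "Yhat_boot n \<omega> = (\<lambda>w. \<J> (Fn n \<omega> x\<^sub>f) - e_boot n \<omega> w)" for n \<omega>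
      by (simp add: e_boot_def)
    have Z_meas: "Z n \<omega> \<in> borel_measurable (Pstar n \<omega>)" for n \<omega>
    proof -
      have "Yhat_boot n \<omega> \<in> borel_measurable (Pstar n \<omega>)"
        unfolding Yhat_boot_e using e_boot_meas by (intro borel_measurable_diff) simp_all
      then show ?thesis
        unfolding Z_def by (intro borel_measurable_times borel_measurable_diff borel_measurable_const)
    qed
    have "tendsto_prob P (\<lambda>n \<omega>. SUP x. \<bar>HB n \<omega> x - cdf L x\<bar>) 0"
    proof (rule reflected_slutsky_in_prob[OF P L])
      show "real_distribution (distr (Pstar n \<omega>) borel (Z n \<omega>))" for n \<omega>
        by (rule prob_space.real_distribution_distr[OF Pstar Z_meas])
      show "weak_conv_in_prob P (\<lambda>n \<omega>. distr (Pstar n \<omega>) borel (Z n \<omega>)) L"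
        using C2_1(5) by (simp add: L_def Z_def[abs_def])
      show "tendsto_prob P c 0"
        using C2_1(7) by (simp add: c_def[abs_def])
      show "\<forall>\<^sub>F n in sequentially. \<forall>\<omega>\<in>space P. \<forall>x. HB n \<omega> x = measure (distr (Pstar n \<omega>) borel (Z n \<omega>)) {y. - y - c n \<omega> \<le> x}"
        using a_\<tau>
      proof eventually_elim
        case (elim n)
        have "a n * e_boot n \<omega> w = - Z n \<omega> w - c n \<omega>" for \<omega> w
          by (simp add: elim e_boot_def Z_def c_def algebra_simps)
        then show ?case
          using Z_meas[of n] by (auto simp: HB_def measure_distr vimage_def Int_def conj_commute)
      qed
      show "(\<lambda>\<omega>. SUP x. \<bar>HB n \<omega> x - cdf L x\<bar>) \<in> borel_measurable P" for n
        by (rule borel_measurable_cdf_distance[OF HB_meas HB_rc HB_01 L.cdf_is_right_cont L_01])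
    qed
    then show ?thesis by (simp add: SB_def[abs_def])
  qed

  \<comment> \<open>The thresholds \<open>\<plusminus> a n * \<delta>\<close> leave every bounded set, so the limit law puts no mass beyond them asymptotically.\<close>
  have tail: "(\<lambda>n. cdf L (- a n * \<delta>) + (1 - cdf L (a n * \<delta>))) \<longlonglongrightarrow> 0" if "\<delta> > 0" for \<delta>
  proof -
    have top: "filterlim (\<lambda>n. a n * \<delta>) at_top sequentially"
      by (rule filterlim_at_top_mult_tendsto_pos[OF tendsto_const that a_top])
    then have bot: "filterlim (\<lambda>n. - a n * \<delta>) at_bot sequentially"
      by (simp add: filterlim_uminus_at_bot)
    have "(\<lambda>n. cdf L (- a n * \<delta>) + (1 - cdf L (a n * \<delta>))) \<longlonglongrightarrow> 0 + (1 - 1)"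
      by (intro tendsto_intros filterlim_compose[OF L.cdf_lim_at_bot bot]
            filterlim_compose[OF L.cdf_lim_at_top_prob top])
    then show ?thesis by simp
  qed

  have e_0: "tendsto_prob P1 e 0"
    unfolding tendsto_prob_def
  proof (intro conjI allI impI e_meas1)
    fix \<delta> :: real assume "\<delta> > 0"
    show "(\<lambda>n. measure P1 {\<omega> \<in> space P1. \<bar>e n \<omega> - 0\<bar> > \<delta>}) \<longlonglongrightarrow> 0"
    proof (rule tendsto_sandwich[OF _ _ tendsto_const])
      show "(\<lambda>n. 2 * SR n + (cdf L (- a n * \<delta>) + (1 - cdf L (a n * \<delta>)))) \<longlonglongrightarrow> 0"
        using tendsto_add[OF tendsto_mult_left[OF SR, of 2] tail[OF \<open>\<delta> > 0\<close>]] by simp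
      have "measure P1 {\<omega> \<in> space P1. \<bar>e n \<omega> - 0\<bar> > \<delta>} \<le> 2 * SR n + (cdf L (- a n * \<delta>) + (1 - cdf L (a n * \<delta>)))" for n
        using prob_exceeds_le[OF P1 e_meas1[of n] a_pos[of n] SR_ge[of n, unfolded HR_def], of \<delta>] by simp
      then show "\<forall>\<^sub>F n in sequentially. measure P1 {\<omega> \<in> space P1. \<bar>e n \<omega> - 0\<bar> > \<delta>} \<le>
          2 * SR n + (cdf L (- a n * \<delta>) + (1 - cdf L (a n * \<delta>)))" by simp
    qed simp
  qed

  have e_boot_0: "tendsto_prob P (\<lambda>n \<omega>. measure (Pstar n \<omega>) {w \<in> space (Pstar n \<omega>). \<bar>e_boot n \<omega> w\<bar> > \<delta>}) 0"
    if "\<delta> > 0" for \<delta>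
  proof (rule tendsto_prob_controlled[OF P])
    show "(\<lambda>\<omega>. measure (Pstar n \<omega>) {w \<in> space (Pstar n \<omega>). \<bar>e_boot n \<omega> w\<bar> > \<delta>}) \<in> borel_measurable P" for n
      by (rule boot_prob_meas) simp
    fix \<eta> :: real assume "\<eta> > 0"
    then have "\<forall>\<^sub>F n in sequentially. cdf L (- a n * \<delta>) + (1 - cdf L (a n * \<delta>)) < \<eta> / 2"
      using order_tendstoD(2)[OF tail[OF that], of "\<eta> / 2"] by simp
    then have "\<forall>\<^sub>F n in sequentially. \<forall>\<omega>\<in>space P. \<bar>SB n \<omega> - 0\<bar> \<le> \<eta> / 4 \<longrightarrow>
        \<bar>measure (Pstar n \<omega>) {w \<in> space (Pstar n \<omega>). \<bar>e_boot n \<omega> w\<bar> > \<delta>} - 0\<bar> \<le> \<eta>"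
    proof (eventually_elim, intro ballI impI)
      fix n \<omega> assume t: "cdf L (- a n * \<delta>) + (1 - cdf L (a n * \<delta>)) < \<eta> / 2" and "\<bar>SB n \<omega> - 0\<bar> \<le> \<eta> / 4"
      then have "\<bar>measure (Pstar n \<omega>) {w \<in> space (Pstar n \<omega>). a n * e_boot n \<omega> w \<le> x} - cdf L x\<bar> \<le> \<eta> / 4" for x
        using SB_ge[of n \<omega> x] unfolding HB_def by linarith
      from prob_exceeds_le[OF Pstar e_boot_meas a_pos this, of \<delta>] t
      show "\<bar>measure (Pstar n \<omega>) {w \<in> space (Pstar n \<omega>). \<bar>e_boot n \<omega> w\<bar> > \<delta>} - 0\<bar> \<le> \<eta>" by simp
    qed
    then show "\<exists>K d. finite K \<and> d > 0 \<and> (\<forall>(V, b)\<in>K. tendsto_prob P V b) \<and>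
      (\<forall>\<^sub>F n in sequentially. \<forall>\<omega>\<in>space P. (\<forall>(V, b)\<in>K. \<bar>V n \<omega> - b\<bar> \<le> d) \<longrightarrow>
        \<bar>measure (Pstar n \<omega>) {w \<in> space (Pstar n \<omega>). \<bar>e_boot n \<omega> w\<bar> > \<delta>} - 0\<bar> \<le> \<eta>)"
      using SB \<open>\<eta> > 0\<close> by (intro exI[of _ "{(SB, 0)}"] exI[of _ "\<eta> / 4"]) auto
  qed

  have e_weak: "weak_conv_m (\<lambda>n. distr P1 borel (\<lambda>\<omega>. a n * e n \<omega>)) L"
    unfolding weak_conv_m_def weak_conv_def HR_cdf[symmetric]
  proof (intro allI impI)
    fix x
    have "(\<lambda>n. HR n x - cdf L x) \<longlonglongrightarrow> 0"
      by (rule Lim_null_comparison[OF always_eventually SR]) (use SR_ge in auto)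
    then show "(\<lambda>n. HR n x) \<longlonglongrightarrow> cdf L x" by (rule Lim_null[THEN iffD2])
  qed

  have e_boot_weak: "weak_conv_in_prob P (\<lambda>n \<omega>. distr (Pstar n \<omega>) borel (\<lambda>w. a n * e_boot n \<omega> w)) L"
    unfolding weak_conv_in_prob_def HB_cdf[symmetric]
  proof (intro allI impI, rule tendsto_prob_controlled[OF P HB_meas])
    fix x \<eta> :: real assume "\<eta> > 0"
    have "\<bar>SB n \<omega> - 0\<bar> \<le> \<eta> \<longrightarrow> \<bar>HB n \<omega> x - cdf L x\<bar> \<le> \<eta>" for n \<omega>
      using SB_ge[of n \<omega> x] by linarith
    then show "\<exists>K d. finite K \<and> d > 0 \<and> (\<forall>(V, b)\<in>K. tendsto_prob P V b) \<and>
      (\<forall>\<^sub>F n in sequentially. \<forall>\<omega>\<in>space P. (\<forall>(V, b)\<in>K. \<bar>V n \<omega> - b\<bar> \<le> d) \<longrightarrow> \<bar>HB n \<omega> x - cdf L x\<bar> \<le> \<eta>)"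
      using SB \<open>\<eta> > 0\<close> by (intro exI[of _ "{(SB, 0)}"] exI[of _ \<eta>]) auto
  qed

  have e_sup: "tendsto_prob P (\<lambda>n \<omega>. SUP x. \<bar>HB n \<omega> x - HR n x\<bar>) 0"
  proof (rule tendsto_prob_controlled[OF P])
    show "(\<lambda>\<omega>. SUP x. \<bar>HB n \<omega> x - HR n x\<bar>) \<in> borel_measurable P" for n
      by (rule borel_measurable_cdf_distance[OF HB_meas HB_rc HB_01 HR_rc HR_01])
    fix \<eta> :: real assume "\<eta> > 0"
    then have "\<forall>\<^sub>F n in sequentially. SR n < \<eta> / 2"
      using order_tendstoD(2)[OF SR, of "\<eta> / 2"] by simp
    then have "\<forall>\<^sub>F n in sequentially. \<forall>\<omega>\<in>space P. \<bar>SB n \<omega> - 0\<bar> \<le> \<eta> / 2 \<longrightarrow>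
        \<bar>(SUP x. \<bar>HB n \<omega> x - HR n x\<bar>) - 0\<bar> \<le> \<eta>"
    proof (eventually_elim, intro ballI impI)
      fix n \<omega> assume "SR n < \<eta> / 2" "\<bar>SB n \<omega> - 0\<bar> \<le> \<eta> / 2"
      then have *: "\<bar>HB n \<omega> x - HR n x\<bar> \<le> \<eta>" for x
        using SB_ge[of n \<omega> x] SR_ge[of n x] by linarith
      show "\<bar>(SUP x. \<bar>HB n \<omega> x - HR n x\<bar>) - 0\<bar> \<le> \<eta>"
        using abs_SUP_abs_le[of "\<lambda>x. HB n \<omega> x - HR n x", OF *] by simp
    qed
    then show "\<exists>K d. finite K \<and> d > 0 \<and> (\<forall>(V, b)\<in>K. tendsto_prob P V b) \<and>
      (\<forall>\<^sub>F n in sequentially. \<forall>\<omega>\<in>space P. (\<forall>(V, b)\<in>K. \<bar>V n \<omega> - b\<bar> \<le> d) \<longrightarrow>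
        \<bar>(SUP x. \<bar>HB n \<omega> x - HR n x\<bar>) - 0\<bar> \<le> \<eta>)"
      using SB \<open>\<eta> > 0\<close> by (intro exI[of _ "{(SB, 0)}"] exI[of _ "\<eta> / 2"]) auto
  qed

  have \<epsilon>_meas: "(\<lambda>p. snd p - \<J> (F x\<^sub>f)) \<in> borel_measurable ?B"
    by (intro borel_measurable_diff borel_measurable_const measurable_snd'') simp
  have \<epsilon>_meas1: "\<epsilon> \<in> borel_measurable P1"
    unfolding \<epsilon>_def P1_def cond_world_def by (rule measurable_compose[OF measurable_snd \<epsilon>_meas])
  have \<epsilon>_law: "measure P1 {\<omega>' \<in> space P1. \<epsilon> \<omega>' \<le> x} = F x\<^sub>f (x + \<J> (F x\<^sub>f))" for x
  proof -
    let ?A = "space (return borel x\<^sub>f) \<times> {..x + \<J> (F x\<^sub>f)}"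
    have "{\<omega>' \<in> space P1. \<epsilon> \<omega>' \<le> x} = space ?N \<times> ?A"
      by (auto simp: P1_def cond_world_def space_pair_measure \<epsilon>_def)
    moreover have "?A \<in> sets ?B" by (rule pair_measureI) auto
    ultimately have "measure P1 {\<omega>' \<in> space P1. \<epsilon> \<omega>' \<le> x} = measure ?B ?A"
      using measure_pair_snd[OF N.prob_space_axioms B.prob_space_axioms] by (simp add: P1_def cond_world_def)
    also have "\<dots> = cdf (interval_measure (F x\<^sub>f)) (x + \<J> (F x\<^sub>f))"
      unfolding cdf_def by (rule measure_pair_snd[OF Rx.prob_space_axioms K.prob_space_axioms]) simp
    finally show ?thesis by (simp add: cdf_K)
  qed
  have \<epsilon>_boot_law: "measure (Pstar n \<omega>) {w \<in> space (Pstar n \<omega>). \<epsilon>_boot n \<omega> w \<le> x} =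
      Fn n \<omega> x\<^sub>f (x + \<J> (Fn n \<omega> x\<^sub>f))" for n \<omega> x
  proof -
    interpret G: real_distribution "interval_measure (Fn n \<omega> x\<^sub>f)" by (rule Fn_dist)
    have "{w \<in> space (Pstar n \<omega>). \<epsilon>_boot n \<omega> w \<le> x} = space (?\<I> n) \<times> {..x + \<J> (Fn n \<omega> x\<^sub>f)}"
      by (auto simp: Pstar_def boot_world_def space_pair_measure \<epsilon>_boot_def)
    then have "measure (Pstar n \<omega>) {w \<in> space (Pstar n \<omega>). \<epsilon>_boot n \<omega> w \<le> x} =
        cdf (interval_measure (Fn n \<omega> x\<^sub>f)) (x + \<J> (Fn n \<omega> x\<^sub>f))"
      using measure_pair_snd[OF measure_pmf.prob_space_axioms G.prob_space_axioms, of "{..x + \<J> (Fn n \<omega> x\<^sub>f)}"]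
      by (simp add: Pstar_def boot_world_def cdf_def)
    then show ?thesis by (simp add: Fn_dist(2))
  qed
  have F_cont: "isCont (F x\<^sub>f) x" for x
    using C1(1) by (simp add: continuous_on_eq_continuous_at)

  have \<epsilon>_nondeg: "nondegenerate (distr P1 borel \<epsilon>)"
  proof (rule nondegenerate_continuous_cdf)
    show "real_distribution (distr P1 borel \<epsilon>)"
      by (rule prob_space.real_distribution_distr[OF P1 \<epsilon>_meas1])
    have "cdf (distr P1 borel \<epsilon>) = (\<lambda>x. F x\<^sub>f (x + \<J> (F x\<^sub>f)))"
      using \<epsilon>_meas1 by (auto simp: \<epsilon>_law[symmetric] cdf_def measure_distr vimage_def Int_def conj_commute)
    then show "isCont (cdf (distr P1 borel \<epsilon>)) x" for x
      by (simp add: isCont_o2[OF _ F_cont])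
  qed

  have \<epsilon>_sup: "tendsto_prob P (\<lambda>n \<omega>. SUP x.
        \<bar>measure (Pstar n \<omega>) {w \<in> space (Pstar n \<omega>). \<epsilon>_boot n \<omega> w \<le> x} -
         measure P1 {\<omega>' \<in> space P1. \<epsilon> \<omega>' \<le> x}\<bar>) 0"
  proof (rule tendsto_prob_controlled[OF P])
    show "(\<lambda>\<omega>. SUP x.
        \<bar>measure (Pstar n \<omega>) {w \<in> space (Pstar n \<omega>). \<epsilon>_boot n \<omega> w \<le> x} -
         measure P1 {\<omega>' \<in> space P1. \<epsilon> \<omega>' \<le> x}\<bar>) \<in> borel_measurable P" for n
    proof (rule borel_measurable_cdf_distance)
      show "(\<lambda>\<omega>. measure (Pstar n \<omega>) {w \<in> space (Pstar n \<omega>). \<epsilon>_boot n \<omega> w \<le> x}) \<in> borel_measurable P" for x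
        unfolding \<epsilon>_boot_law
        using measurable_compose[OF measurable_Pair[OF data_meas measurable_Pair[OF
            measurable_const[of x\<^sub>f] borel_measurable_add[OF borel_measurable_const[of x] J_meas]]] Fhat_measurable, of n n]
        by (simp add: Fn_def)
      show "continuous (at_right x) (\<lambda>x. measure (Pstar n \<omega>) {w \<in> space (Pstar n \<omega>). \<epsilon>_boot n \<omega> w \<le> x})" for \<omega> x
        unfolding \<epsilon>_boot_def using Y_boot_meas by (intro right_continuous_prob_le[OF Pstar]) simp
      show "continuous (at_right x) (\<lambda>x. measure P1 {\<omega>' \<in> space P1. \<epsilon> \<omega>' \<le> x})" for x
        by (rule right_continuous_prob_le[OF P1 \<epsilon>_meas1])
    qed (use prob_space.prob_le_1[OF P1] prob_space.prob_le_1[OF Pstar] in auto)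
    fix \<eta> :: real assume "\<eta> > 0"
    then have "\<eta> / 2 > 0" by simp
    obtain d where d: "d > 0" "\<And>x y. \<bar>x - y\<bar> \<le> d \<Longrightarrow> \<bar>F x\<^sub>f x - F x\<^sub>f y\<bar> \<le> \<eta> / 2"
      using cdf_uniformly_continuous[OF K.real_distribution_axioms _ \<open>\<eta> / 2 > 0\<close>] F_cont
      unfolding cdf_K by blast
    let ?S = "\<lambda>n \<omega>. SUP u. \<bar>Fn n \<omega> x\<^sub>f u - F x\<^sub>f u\<bar>"
    let ?J = "\<lambda>n \<omega>. \<J> (Fn n \<omega> x\<^sub>f)"
    \<comment> \<open>Compare both functions with \<open>F x\<^sub>f\<close> at the argument shifted by \<open>\<J> (Fn n \<omega> x\<^sub>f)\<close>.\<close>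
    have *: "\<bar>(SUP x. \<bar>Fn n \<omega> x\<^sub>f (x + ?J n \<omega>) - F x\<^sub>f (x + \<J> (F x\<^sub>f))\<bar>) - 0\<bar> \<le> \<eta>"
      if S: "\<bar>?S n \<omega> - 0\<bar> \<le> min d (\<eta> / 2)" and J: "\<bar>?J n \<omega> - \<J> (F x\<^sub>f)\<bar> \<le> min d (\<eta> / 2)" for n \<omega>
    proof -
      interpret G: real_distribution "interval_measure (Fn n \<omega> x\<^sub>f)" by (rule Fn_dist)
      have "\<bar>Fn n \<omega> x\<^sub>f u - F x\<^sub>f u\<bar> \<le> 1" for u
        using K.cdf_nonneg[of u] K.cdf_bounded_prob[of u] G.cdf_nonneg[of u] G.cdf_bounded_prob[of u]
        unfolding cdf_K Fn_dist(2) by linarith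
      from abs_le_SUP[of "\<lambda>u. Fn n \<omega> x\<^sub>f u - F x\<^sub>f u", OF this]
      have "\<bar>Fn n \<omega> x\<^sub>f u - F x\<^sub>f u\<bar> \<le> \<eta> / 2" for u
        using S by (smt (verit))
      moreover have "\<bar>F x\<^sub>f (x + ?J n \<omega>) - F x\<^sub>f (x + \<J> (F x\<^sub>f))\<bar> \<le> \<eta> / 2" for x
        using J by (intro d(2)) simp
      ultimately have **: "\<bar>Fn n \<omega> x\<^sub>f (x + ?J n \<omega>) - F x\<^sub>f (x + \<J> (F x\<^sub>f))\<bar> \<le> \<eta>" for x
        by (smt (verit) field_sum_of_halves)
      show ?thesis
        using abs_SUP_abs_le[of "\<lambda>x. Fn n \<omega> x\<^sub>f (x + ?J n \<omega>) - F x\<^sub>f (x + \<J> (F x\<^sub>f))", OF **]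
        by simp
    qed
    show "\<exists>K d. finite K \<and> d > 0 \<and> (\<forall>(V, b)\<in>K. tendsto_prob P V b) \<and>
      (\<forall>\<^sub>F n in sequentially. \<forall>\<omega>\<in>space P. (\<forall>(V, b)\<in>K. \<bar>V n \<omega> - b\<bar> \<le> d) \<longrightarrow>
        \<bar>(SUP x. \<bar>measure (Pstar n \<omega>) {w \<in> space (Pstar n \<omega>). \<epsilon>_boot n \<omega> w \<le> x} -
         measure P1 {\<omega>' \<in> space P1. \<epsilon> \<omega>' \<le> x}\<bar>) - 0\<bar> \<le> \<eta>)"
      unfolding \<epsilon>_law \<epsilon>_boot_law
    proof (intro exI conjI)
      show "finite {(?S, 0), (?J, \<J> (F x\<^sub>f))}" "min d (\<eta> / 2) > 0"
        using d(1) \<open>\<eta> > 0\<close> by auto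
      show "\<forall>(V, b)\<in>{(?S, 0), (?J, \<J> (F x\<^sub>f))}. tendsto_prob P V b"
        using C1(2) C2_2 by auto
    qed (use * in auto)
  qed

  have indep: "prob_space.indep_var P1 borel \<epsilon> borel (e n)" for n
    using indep_var_snd_fst[OF N.prob_space_axioms B.prob_space_axioms h_meas \<epsilon>_meas]
    by (simp add: P1_def cond_world_def \<epsilon>_def e_h[abs_def])
  have indep_boot: "prob_space.indep_var (Pstar n \<omega>) borel (\<epsilon>_boot n \<omega>) borel (e_boot n \<omega>)" for n \<omega>
  proof -
    interpret G: real_distribution "interval_measure (Fn n \<omega> x\<^sub>f)" by (rule Fn_dist)
    have "prob_space.indep_var (?\<I> n \<Otimes>\<^sub>M interval_measure (Fn n \<omega> x\<^sub>f))
        borel (\<lambda>w. snd w - \<J> (Fn n \<omega> x\<^sub>f)) borel (\<lambda>w. \<J> (Fn n \<omega> x\<^sub>f) - V n \<omega> (fst w))"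
      by (rule indep_var_snd_fst[OF measure_pmf.prob_space_axioms G.prob_space_axioms]) auto
    then show ?thesis
      by (simp add: Pstar_def boot_world_def \<epsilon>_boot_def e_boot_V[abs_def])
  qed

  show ?thesis
  proof (intro conjI allI impI ballI)
    show "R n \<omega> = \<epsilon> \<omega> + e n \<omega>" for n \<omega>
      by (simp add: R_def \<epsilon>_def e_def)
    show "R_boot n \<omega> w = \<epsilon>_boot n \<omega> w + e_boot n \<omega> w" for n \<omega> w
      by (simp add: R_boot_def \<epsilon>_boot_def e_boot_def)
    show "\<exists>a :: nat \<Rightarrow> real. (\<forall>n. a n > 0) \<and> filterlim a at_top sequentially \<and>
        (\<exists>L. real_distribution L \<and> nondegenerate L \<and>
           weak_conv_m (\<lambda>n. distr P1 borel (\<lambda>\<omega>. a n * e n \<omega>)) L) \<and>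
        (\<exists>L. real_distribution L \<and> nondegenerate L \<and>
           weak_conv_in_prob P (\<lambda>n \<omega>. distr (Pstar n \<omega>) borel (\<lambda>w. a n * e_boot n \<omega> w)) L) \<and>
        tendsto_prob P (\<lambda>n \<omega>. SUP x.
          \<bar>measure (Pstar n \<omega>) {w \<in> space (Pstar n \<omega>). a n * e_boot n \<omega> w \<le> x} -
           measure P1 {\<omega>' \<in> space P1. a n * e n \<omega>' \<le> x}\<bar>) 0"
      using a_pos a_top L(1) L_nondeg e_weak e_boot_weak e_sup[unfolded HB_def HR_def] by blast
    show "prob_space.indep_var (Pstar n \<omega>) borel (\<epsilon>_boot n \<omega>) borel (e_boot n \<omega>)" for n \<omega>
      by (rule indep_boot)
  qed (fact \<epsilon>_nondeg e_0 e_boot_0 \<epsilon>_sup indep)+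
qed

end
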